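(* Let $D$ be an integral domain, let $A=\{f\in D[X] : f(0)=1\}$, and let $D[X]_A$ be the Anderson ring of $D$. Then $\mathfrak{m}$ is a maximal $w$-ideal of $D[X]_A$ if and only if $\mathfrak{m}$ is exactly one of the form (1) $MD[X]_A$ for some maximal $w$-ideal $M$ of $D$, or (2) $\mathfrak{p}D[X]_A$, where $\mathfrak{p}$ is a maximal $w$-ideal of $D[X]$ which is an upper to zero in $D[X]$ disjoint from $A$.
   Context: The Anderson ring $D[X]_A$ is the localization of the polynomial ring $D[X]$ at the multiplicative set $A$ of polynomials with constant term $1$. For an integral domain $E$ with quotient field $L$ and a nonzero fractional ideal $I$ of $E$: $I^{-1}=\{a\in L : aI\subseteq E\}$ and $I_v=(I^{-1})^{-1}$. $\mathrm{GV}(E)$ is the set of (nonzero) finitely generated ideals $J$ of $E$ with $J_v=E$, and $I_w=\{x\in L : xJ\subseteq I \text{ for some } J\in \mathrm{GV}(E)\}$. A nonzero (fractional) ideal $I$ is a $w$-ideal if $I_w=I$. A maximal $w$-ideal is a (nonzero) proper $w$-ideal of $E$ that is not properly contained in any proper $w$-ideal of $E$. An upper to zero in $D[X]$ is a nonzero prime ideal $P$ of $D[X]$ with $P\cap D=(0)$. *)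

theory Defs
  imports "HOL-Computational_Algebra.Polynomial_Factorial" "HOL.Hull"
begin

section \<open>Integral domains inside their quotient field\<close>

text \<open>
  An integral domain is given either as a type of class \<^class>\<open>idom\<close>, or as a subset \<open>E\<close> of a type
  \<open>'f\<close> of class \<^class>\<open>field\<close> that is a subring with quotient field \<open>'f\<close>.
  The notions below take \<open>E\<close> as a parameter and are meant for \<open>E\<close> satisfying
  \<open>domain_with_quotient_field E\<close>.
\<close>

definition domain_with_quotient_field :: "'f::field set \<Rightarrow> bool" where
  "domain_with_quotient_field E \<longleftrightarrow>
     1 \<in> E \<and> (\<forall>x\<in>E. \<forall>y\<in>E. x - y \<in> E \<and> x * y \<in> E) \<and>
     (\<forall>z. \<exists>x\<in>E. \<exists>y\<in>E. y \<noteq> 0 \<and> z = x / y)"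

definition submodule :: "'r::comm_ring_1 set \<Rightarrow> 'r set \<Rightarrow> bool" where
  "submodule E I \<longleftrightarrow> 0 \<in> I \<and> (\<forall>x\<in>I. \<forall>y\<in>I. x + y \<in> I) \<and> (\<forall>e\<in>E. \<forall>x\<in>I. e * x \<in> I)"

definition ideal_of :: "'r::comm_ring_1 set \<Rightarrow> 'r set \<Rightarrow> bool" where
  "ideal_of E I \<longleftrightarrow> submodule E I \<and> I \<subseteq> E"

definition prime_ideal_of :: "'r::comm_ring_1 set \<Rightarrow> 'r set \<Rightarrow> bool" where
  "prime_ideal_of E P \<longleftrightarrow>
     ideal_of E P \<and> P \<noteq> E \<and> (\<forall>x\<in>E. \<forall>y\<in>E. x * y \<in> P \<longrightarrow> x \<in> P \<or> y \<in> P)"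

text \<open>For \<open>S \<subseteq> E\<close> this is the ideal of \<open>E\<close> generated by \<open>S\<close>.\<close>

definition gen :: "'r::comm_ring_1 set \<Rightarrow> 'r set \<Rightarrow> 'r set" where
  "gen E S = submodule E hull S"

definition finitely_generated :: "'r::comm_ring_1 set \<Rightarrow> 'r set \<Rightarrow> bool" where
  "finitely_generated E I \<longleftrightarrow> (\<exists>S. finite S \<and> I = gen E S)"

definition fractional_ideal :: "'f::field set \<Rightarrow> 'f set \<Rightarrow> bool" where
  "fractional_ideal E I \<longleftrightarrow> submodule E I \<and> (\<exists>d\<in>E. d \<noteq> 0 \<and> (\<forall>x\<in>I. d * x \<in> E))"

section \<open>The \<open>v\<close>- and \<open>w\<close>-operations\<close>

definition inv_ideal :: "'f::field set \<Rightarrow> 'f set \<Rightarrow> 'f set" where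
  "inv_ideal E I = {a. \<forall>x\<in>I. a * x \<in> E}"

definition v_closure :: "'f::field set \<Rightarrow> 'f set \<Rightarrow> 'f set" where
  "v_closure E I = inv_ideal E (inv_ideal E I)"

definition GV :: "'f::field set \<Rightarrow> 'f set set" where
  "GV E = {J. ideal_of E J \<and> J \<noteq> {0} \<and> finitely_generated E J \<and> v_closure E J = E}"

definition w_closure :: "'f::field set \<Rightarrow> 'f set \<Rightarrow> 'f set" where
  "w_closure E I = {x. \<exists>J\<in>GV E. \<forall>y\<in>J. x * y \<in> I}"

definition w_ideal :: "'f::field set \<Rightarrow> 'f set \<Rightarrow> bool" where
  "w_ideal E I \<longleftrightarrow> fractional_ideal E I \<and> I \<noteq> {0} \<and> w_closure E I = I"

definition proper_w_ideal :: "'f::field set \<Rightarrow> 'f set \<Rightarrow> bool" where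
  "proper_w_ideal E I \<longleftrightarrow> w_ideal E I \<and> I \<subset> E"

definition maximal_w_ideal :: "'f::field set \<Rightarrow> 'f set \<Rightarrow> bool" where
  "maximal_w_ideal E M \<longleftrightarrow> proper_w_ideal E M \<and> \<not> (\<exists>I. proper_w_ideal E I \<and> M \<subset> I)"

text \<open>For a domain given as a type, use its canonical copy inside its field of fractions.\<close>

definition maximal_w_ideal_idom :: "'a::idom set \<Rightarrow> bool" where
  "maximal_w_ideal_idom M \<longleftrightarrow> maximal_w_ideal (range to_fract) (to_fract ` M)"

section \<open>Polynomials and the Anderson ring\<close>

definition const_poly :: "'a::zero \<Rightarrow> 'a poly" where
  "const_poly a = [:a:]"

definition upper_to_zero :: "'a::idom poly set \<Rightarrow> bool" where
  "upper_to_zero P \<longleftrightarrow> prime_ideal_of UNIV P \<and> P \<noteq> {0} \<and> P \<inter> range const_poly = {0}"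

definition anderson_set :: "'a::idom poly set" where
  "anderson_set = {f. poly f 0 = 1}"

definition anderson_ring :: "'a::idom poly fract set" where
  "anderson_ring = {to_fract f / to_fract g | f g. g \<in> anderson_set}"

lemma range_to_fract_domain: "domain_with_quotient_field (range (to_fract :: 'a::idom \<Rightarrow> _))"
proof -
  have "\<exists>x\<in>range to_fract. \<exists>y\<in>range to_fract. y \<noteq> 0 \<and> z = x / y" for z :: "'a fract"
  proof (cases z)
    case (Fract a b)
    then have "to_fract b \<noteq> 0 \<and> z = to_fract a / to_fract b"
      by (simp add: Fract_conv_to_fract)
    then show ?thesis by blast
  qed
  moreover have "1 \<in> range (to_fract :: 'a \<Rightarrow> _)"
    by (rule range_eqI[of _ _ 1]) simp
  ultimately show ?thesis
    unfolding domain_with_quotient_field_def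
    by (auto simp flip: to_fract_diff to_fract_mult)
qed

lemma anderson_ring_domain:
  "domain_with_quotient_field (anderson_ring :: 'a::idom poly fract set)"
proof -
  have nz: "to_fract g \<noteq> 0" if "g \<in> anderson_set" for g :: "'a poly"
    using that by (auto simp: anderson_set_def)
  have incl: "to_fract f \<in> anderson_ring" for f :: "'a poly"
    unfolding anderson_ring_def anderson_set_def
    by (rule CollectI, rule exI[of _ f], rule exI[of _ 1]) simp
  have closed: "x - y \<in> anderson_ring \<and> x * y \<in> anderson_ring"
    if xy: "x \<in> anderson_ring" "y \<in> anderson_ring" for x y :: "'a poly fract"
  proof -
    obtain f g f' g' where x: "x = to_fract f / to_fract g" "g \<in> anderson_set"
      and y: "y = to_fract f' / to_fract g'" "g' \<in> anderson_set"
      using xy unfolding anderson_ring_def by blast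
    have gg: "g * g' \<in> anderson_set" using x y by (simp add: anderson_set_def)
    have "x - y = to_fract (f * g' - f' * g) / to_fract (g * g')"
      using nz[OF x(2)] nz[OF y(2)] by (simp add: x(1) y(1) diff_frac_eq)
    moreover have "x * y = to_fract (f * f') / to_fract (g * g')"
      by (simp add: x(1) y(1))
    ultimately show ?thesis using gg unfolding anderson_ring_def by blast
  qed
  have "\<exists>x\<in>anderson_ring. \<exists>y\<in>anderson_ring. y \<noteq> 0 \<and> z = x / y" for z :: "'a poly fract"
    using range_to_fract_domain[where 'a = "'a poly"] incl
    unfolding domain_with_quotient_field_def by (metis imageE)
  then show ?thesis
    using closed incl[of 1] unfolding domain_with_quotient_field_def by simp
qed

text \<open>The extensions to the Anderson ring of an ideal of \<open>D\<close> and of an ideal of \<open>D[X]\<close>.\<close>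

definition extend_base :: "'a::idom set \<Rightarrow> 'a poly fract set" where
  "extend_base M = gen anderson_ring ((\<lambda>a. to_fract (const_poly a)) ` M)"

definition extend_poly :: "'a::idom poly set \<Rightarrow> 'a poly fract set" where
  "extend_poly P = gen anderson_ring (to_fract ` P)"

end

theory Submission
  imports Defs
begin

text \<open>
  Write \<open>K\<close> for the quotient field of \<open>D\<close>, \<open>T\<close> for the Anderson ring, and \<open>M[X]\<close> for the set of
  polynomials with all coefficients in \<open>M\<close>. A finitely generated ideal \<open>J\<close> of a domain \<open>E\<close> belongs to
  \<open>GV(E)\<close> iff \<open>J\<close> is nonzero and \<open>J\<^sup>-\<^sup>1 = E\<close>. This can be read off from a finite generating set \<open>F\<close>:
  \<open>xF \<subseteq> E\<close> implies \<open>x \<in> E\<close>. Such an \<open>F\<close> is called a GV set below (\<open>gv_set\<close>). Zorn's lemma puts every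
  nonzero ideal without a GV set into a maximal \<open>w\<close>-ideal, maximal \<open>w\<close>-ideals are prime, and a nonzero
  prime that contains no GV set is a proper \<open>w\<close>-ideal.

  Three facts then carry the proof.

  \<^item> Content. If finitely many constants, not all zero, form a GV set of \<open>D\<close> together with the
    coefficients of a polynomial \<open>g\<close>, then these constants form a GV set of \<open>D[X]\<close> together with \<open>g\<close>
    (\<open>gv_idom_const_polys_insert\<close>, which rests on a weak form of the Dedekind-Mertens lemma,
    \<open>const_dvd_of_content_closed\<close>), hence of \<open>T\<close>. Consequently an ideal of \<open>D[X]\<close> that has a nonzero
    constant and no GV set lies in \<open>M[X]\<close> for some maximal \<open>w\<close>-ideal \<open>M\<close> of \<open>D\<close>
    (\<open>ideal_subset_coeffs_in_maximal\<close>).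

  \<^item> The candidates are proper \<open>w\<close>-ideals of \<open>T\<close>. Suppose that a GV set \<open>F\<close> of \<open>T\<close> lies in \<open>PT\<close>;
    after clearing denominators, \<open>F \<subseteq> P\<close>. If \<open>P = M[X]\<close>, then the coefficients of \<open>F\<close> lie in \<open>M\<close>, so
    some \<open>a \<in> K\<close> outside \<open>D\<close> satisfies \<open>aF \<subseteq> D[X]\<close>, whence \<open>a \<in> T\<close>; but \<open>T \<inter> K = D\<close>. If \<open>P\<close> is an upper
    to zero and \<open>f \<in> P\<close> is nonzero of least degree, then \<open>(c/f)F \<subseteq> D[X]\<close> for some nonzero \<open>c \<in> D\<close>;
    hence \<open>c/f \<in> T\<close>, so \<open>ct \<in> fD[X] \<subseteq> P\<close> for some \<open>t \<in> A\<close>, which puts \<open>t\<close> into \<open>P\<close>, against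
    \<open>P \<inter> A = {}\<close>.

  \<^item> An ideal of \<open>D[X]\<close> properly above an upper to zero contains a nonzero constant
    (\<open>ideal_above_upper_to_zero\<close>), because over \<open>K\<close> an upper to zero becomes a maximal ideal.

  Proper \<open>w\<close>-ideals of \<open>T\<close> contract to proper \<open>w\<close>-ideals of \<open>D[X]\<close>. So if \<open>\<pp>\<close> is a maximal \<open>w\<close>-ideal
  of \<open>D[X]\<close> and an upper to zero disjoint from \<open>A\<close>, then \<open>\<pp>T\<close> is maximal because \<open>\<pp>\<close> is. And \<open>MT\<close> is
  maximal by the first fact: anything larger contains some \<open>g \<in> D[X]\<close> outside \<open>M[X]\<close>, and \<open>g\<close> forms a
  GV set together with suitable constants from \<open>M\<close>. Conversely, let \<open>\<mm>\<close> be a maximal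
  \<open>w\<close>-ideal of \<open>T\<close> and \<open>\<pp> = \<mm> \<inter> D[X]\<close>, so that \<open>\<mm> = \<pp>T\<close>. As soon as \<open>\<pp>\<close> lies in an ideal
  of \<open>D[X]\<close> with a nonzero constant and no GV set, \<open>\<pp> \<subseteq> M[X]\<close> for a maximal \<open>w\<close>-ideal \<open>M\<close> of \<open>D\<close>, so
  \<open>\<mm> \<subseteq> MT\<close> and equality holds by maximality of \<open>\<mm>\<close>. This applies to \<open>\<pp>\<close> itself if \<open>\<pp> \<inter> D \<noteq> 0\<close>,
  and to any proper \<open>w\<close>-ideal properly above \<open>\<pp>\<close> if \<open>\<pp>\<close> is an upper to zero that is not a maximal
  \<open>w\<close>-ideal; in the remaining case \<open>\<pp>\<close> is as required for the second form. The two forms exclude each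
  other since \<open>MT\<close> contains nonzero constants and \<open>\<pp>T\<close> does not.
\<close>

section \<open>The w-operation in terms of finite sets\<close>

definition gv_set :: "'f::field set \<Rightarrow> 'f set \<Rightarrow> bool" where
  "gv_set E F \<longleftrightarrow> finite F \<and> F \<subseteq> E \<and> \<not> F \<subseteq> {0} \<and> (\<forall>x. (\<forall>f\<in>F. x * f \<in> E) \<longrightarrow> x \<in> E)"

lemma submodule_Inter: "(\<And>I. I \<in> \<I> \<Longrightarrow> submodule E I) \<Longrightarrow> submodule E (\<Inter>\<I>)"
  unfolding submodule_def by blast

lemma submodule_zero: "submodule E I \<Longrightarrow> 0 \<in> I"
  and submodule_add: "submodule E I \<Longrightarrow> x \<in> I \<Longrightarrow> y \<in> I \<Longrightarrow> x + y \<in> I"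
  and submodule_mult: "submodule E I \<Longrightarrow> e \<in> E \<Longrightarrow> x \<in> I \<Longrightarrow> e * x \<in> I"
  unfolding submodule_def by blast+

lemma submodule_gen: "submodule E (gen E S)"
  unfolding gen_def by (rule hull_in) (auto intro: submodule_Inter)

lemma gen_superset: "S \<subseteq> gen E S"
  unfolding gen_def by (rule hull_subset)

lemma gen_least: "S \<subseteq> I \<Longrightarrow> submodule E I \<Longrightarrow> gen E S \<subseteq> I"
  unfolding gen_def by (rule hull_minimal)

context
  fixes E :: "'f::field set"
  assumes dom: "domain_with_quotient_field E"
begin

lemma one_mem: "1 \<in> E" and diff_mem: "x \<in> E \<Longrightarrow> y \<in> E \<Longrightarrow> x - y \<in> E"
  and mult_mem: "x \<in> E \<Longrightarrow> y \<in> E \<Longrightarrow> x * y \<in> E"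
  using dom unfolding domain_with_quotient_field_def by auto

lemma zero_mem: "0 \<in> E"
  using diff_mem[OF one_mem one_mem] by simp

lemma add_mem: "x \<in> E \<Longrightarrow> y \<in> E \<Longrightarrow> x + y \<in> E"
  using diff_mem[of x "0 - y"] diff_mem[OF zero_mem, of y] by simp

lemma submodule_self: "submodule E E"
  unfolding submodule_def using zero_mem add_mem mult_mem by auto

lemma submodule_preimage: "submodule E I \<Longrightarrow> submodule E {y. x * y \<in> I}"
  unfolding submodule_def by (auto simp: distrib_left mult.left_commute)

lemma gv_set_gen_GV:
  assumes F: "gv_set E F"
  shows "gen E F \<in> GV E"
proof -
  have sub: "gen E F \<subseteq> E"
    using F submodule_self by (intro gen_least) (auto simp: gv_set_def)
  have "inv_ideal E (gen E F) = E"
  proof (intro equalityI subsetI)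
    fix x assume "x \<in> inv_ideal E (gen E F)"
    then have "\<forall>f\<in>F. x * f \<in> E"
      using gen_superset[of F E] unfolding inv_ideal_def by auto
    then show "x \<in> E" using F unfolding gv_set_def by blast
  next
    fix x assume "x \<in> E"
    then show "x \<in> inv_ideal E (gen E F)"
      using sub mult_mem unfolding inv_ideal_def by auto
  qed
  moreover have "inv_ideal E E = E"
    using one_mem mult_mem unfolding inv_ideal_def by force
  ultimately have "v_closure E (gen E F) = E"
    unfolding v_closure_def by simp
  moreover have "gen E F \<noteq> {0}"
    using F gen_superset[of F E] unfolding gv_set_def by blast
  ultimately show ?thesis
    using F sub submodule_gen[of E F]
    unfolding GV_def ideal_of_def finitely_generated_def gv_set_def by blast
qed

lemma GV_obtain_gv_set:
  assumes J: "J \<in> GV E"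
  obtains F where "gv_set E F" "F \<subseteq> J"
proof -
  obtain F where F: "finite F" "J = gen E F"
    using J unfolding GV_def finitely_generated_def by blast
  have FJ: "F \<subseteq> J" using F gen_superset by blast
  have nz: "\<not> F \<subseteq> {0}"
  proof
    assume "F \<subseteq> {0}"
    then have "J \<subseteq> {0}"
      unfolding F by (intro gen_least) (auto simp: submodule_def)
    moreover have "0 \<in> J" using submodule_gen[of E F] unfolding F submodule_def by blast
    ultimately show False using J unfolding GV_def by blast
  qed
  have inv: "x \<in> E" if x: "\<forall>f\<in>F. x * f \<in> E" for x
  proof -
    have "J \<subseteq> {y. x * y \<in> E}"
      unfolding F using x by (intro gen_least submodule_preimage submodule_self) auto
    then have "x \<in> inv_ideal E J" unfolding inv_ideal_def by auto
    moreover have "1 \<in> v_closure E J" using J one_mem unfolding GV_def by simp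
    ultimately show "x \<in> E" unfolding v_closure_def inv_ideal_def[of E "inv_ideal E J"] by force
  qed
  have "gv_set E F"
    using F FJ nz inv J unfolding gv_set_def GV_def ideal_of_def by blast
  then show thesis using that FJ by blast
qed

lemma w_closure_iff_gv_set:
  assumes I: "submodule E I"
  shows "x \<in> w_closure E I \<longleftrightarrow> (\<exists>F. gv_set E F \<and> (\<forall>f\<in>F. x * f \<in> I))"
proof
  assume "x \<in> w_closure E I"
  then show "\<exists>F. gv_set E F \<and> (\<forall>f\<in>F. x * f \<in> I)"
    unfolding w_closure_def by (auto elim!: GV_obtain_gv_set)
next
  assume "\<exists>F. gv_set E F \<and> (\<forall>f\<in>F. x * f \<in> I)"
  then obtain F where F: "gv_set E F" "\<forall>f\<in>F. x * f \<in> I" by blast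
  then have "gen E F \<subseteq> {y. x * y \<in> I}"
    by (intro gen_least submodule_preimage I) auto
  then show "x \<in> w_closure E I"
    using gv_set_gen_GV[OF F(1)] unfolding w_closure_def by blast
qed

text \<open>
  Testing with GV sets makes the \<open>w\<close>-closure finitary. Moreover only \<open>x \<in> E\<close> has to be tested: an
  \<open>x\<close> that a GV set multiplies into \<open>I \<subseteq> E\<close> lies in \<open>E\<close> by the defining property of GV sets.
\<close>

lemma proper_w_ideal_iff:
  "proper_w_ideal E I \<longleftrightarrow>
     submodule E I \<and> I \<subseteq> E \<and> I \<noteq> {0} \<and> 1 \<notin> I \<and>
     (\<forall>x\<in>E. \<forall>F. gv_set E F \<longrightarrow> (\<forall>f\<in>F. x * f \<in> I) \<longrightarrow> x \<in> I)"
proof (cases "submodule E I \<and> I \<subseteq> E")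
  case True
  then have sub: "submodule E I" and IE: "I \<subseteq> E" by auto
  have "gv_set E {1}" using one_mem unfolding gv_set_def by auto
  then have "I \<subseteq> w_closure E I" using w_closure_iff_gv_set[OF sub] by fastforce
  moreover have "w_closure E I \<subseteq> E"
    using IE unfolding subset_iff w_closure_iff_gv_set[OF sub] gv_set_def by blast
  ultimately have "w_closure E I = I \<longleftrightarrow> (\<forall>x\<in>E. x \<in> w_closure E I \<longrightarrow> x \<in> I)" by blast
  moreover have "I \<subset> E \<longleftrightarrow> 1 \<notin> I"
    using sub IE one_mem unfolding submodule_def by (metis mult.right_neutral psubsetI psubsetE subsetI)
  moreover have "fractional_ideal E I"
    using sub IE one_mem unfolding fractional_ideal_def by (metis mult_1 subsetD zero_neq_one)
  ultimately show ?thesis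
    unfolding proper_w_ideal_def w_ideal_def w_closure_iff_gv_set[OF sub]
    using sub IE by blast
next
  case False
  then show ?thesis
    unfolding proper_w_ideal_def w_ideal_def fractional_ideal_def by blast
qed

lemma proper_w_ideal_no_gv_set:
  assumes "proper_w_ideal E I" "gv_set E F"
  shows "\<not> F \<subseteq> I"
  using assms one_mem unfolding proper_w_ideal_iff by fastforce

section \<open>Maximal w-ideals\<close>

text \<open>
  The products are tested one factor at a time: if \<open>xFG \<subseteq> E\<close>, then \<open>xf \<in> E\<close> for each \<open>f \<in> F\<close>
  because \<open>G\<close> is a GV set, and so \<open>x \<in> E\<close> because \<open>F\<close> is one. This replaces the
  idempotence of the \<open>w\<close>-operation.
\<close>

lemma gv_set_mult:
  assumes F: "gv_set E F" and G: "gv_set E G"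
  shows "gv_set E ((\<lambda>(f, g). f * g) ` (F \<times> G))"
proof -
  obtain f g where "f \<in> F" "f \<noteq> 0" "g \<in> G" "g \<noteq> 0"
    using F G unfolding gv_set_def by blast
  then have "f * g \<in> (\<lambda>(f, g). f * g) ` (F \<times> G)" "f * g \<noteq> 0" by auto
  then have nz: "\<not> (\<lambda>(f, g). f * g) ` (F \<times> G) \<subseteq> {0}" by blast
  have "x \<in> E" if x: "\<forall>h\<in>(\<lambda>(f, g). f * g) ` (F \<times> G). x * h \<in> E" for x
  proof -
    have "x * f \<in> E" if f: "f \<in> F" for f
    proof -
      have "\<forall>g\<in>G. (x * f) * g \<in> E" using x f by (auto simp: mult.assoc)
      then show ?thesis using G unfolding gv_set_def by blast
    qed
    then show ?thesis using F unfolding gv_set_def by blast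
  qed
  moreover have "finite ((\<lambda>(f, g). f * g) ` (F \<times> G))"
    using F G unfolding gv_set_def by simp
  moreover have "(\<lambda>(f, g). f * g) ` (F \<times> G) \<subseteq> E"
    using F G unfolding gv_set_def by (auto intro!: mult_mem)
  ultimately show ?thesis
    using nz unfolding gv_set_def by blast
qed

definition adjoin :: "'f set \<Rightarrow> 'f \<Rightarrow> 'f set" where
  "adjoin I x = {i + x * e | i e. i \<in> I \<and> e \<in> E}"

lemma adjoin_ideal:
  assumes I: "submodule E I" "I \<subseteq> E" and x: "x \<in> E"
  shows "submodule E (adjoin I x)" "adjoin I x \<subseteq> E" "I \<subseteq> adjoin I x" "x \<in> adjoin I x"
proof -
  have N: "i + x * e \<in> adjoin I x" if "i \<in> I" "e \<in> E" for i e
    using that unfolding adjoin_def by blast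
  have "0 \<in> adjoin I x" using N[of 0 0] submodule_zero[OF I(1)] zero_mem by simp
  moreover have "y + z \<in> adjoin I x" if yz: "y \<in> adjoin I x" "z \<in> adjoin I x" for y z
  proof -
    obtain i e i' e' where *: "y = i + x * e" "z = i' + x * e'" "i \<in> I" "e \<in> E" "i' \<in> I" "e' \<in> E"
      using yz unfolding adjoin_def by blast
    then have "i + i' + x * (e + e') \<in> adjoin I x"
      by (intro N submodule_add[OF I(1)] add_mem)
    then show ?thesis using * by (simp add: algebra_simps)
  qed
  moreover have "a * y \<in> adjoin I x" if a: "a \<in> E" and y: "y \<in> adjoin I x" for a y
  proof -
    obtain i e where *: "y = i + x * e" "i \<in> I" "e \<in> E" using y unfolding adjoin_def by blast
    then have "a * i + x * (a * e) \<in> adjoin I x"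
      using a by (intro N submodule_mult[OF I(1)] mult_mem)
    then show ?thesis using * by (simp add: algebra_simps)
  qed
  ultimately show "submodule E (adjoin I x)" unfolding submodule_def by blast
  show "adjoin I x \<subseteq> E" unfolding adjoin_def using I(2) x add_mem mult_mem by blast
  show "I \<subseteq> adjoin I x" using N[OF _ zero_mem] by auto
  show "x \<in> adjoin I x" using N[OF submodule_zero[OF I(1)] one_mem] by simp
qed

text \<open>
  GV sets are finite, so ideals without GV sets are closed under unions of chains, and Zorn's lemma
  gives a maximal such ideal \<open>M\<close> above \<open>I\<close>. It is \<open>w\<close>-closed: if \<open>xF \<subseteq> M\<close> with \<open>x \<notin> M\<close>, then
  \<open>M + xE\<close> contains a GV set \<open>G\<close>, and the GV set \<open>FG\<close> lies in \<open>FM + xFE \<subseteq> M\<close>.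
\<close>

lemma ex_maximal_w_ideal:
  assumes I: "submodule E I" "I \<subseteq> E" "I \<noteq> {0}" and no: "\<And>F. gv_set E F \<Longrightarrow> \<not> F \<subseteq> I"
  shows "\<exists>M. maximal_w_ideal E M \<and> I \<subseteq> M"
proof -
  define \<A> where "\<A> = {N. submodule E N \<and> N \<subseteq> E \<and> I \<subseteq> N \<and> (\<forall>F. gv_set E F \<longrightarrow> \<not> F \<subseteq> N)}"
  have "\<exists>U\<in>\<A>. \<forall>X\<in>C. X \<subseteq> U" if C: "subset.chain \<A> C" for C
  proof (cases "C = {}")
    case True
    then show ?thesis using I no by (auto simp: \<A>_def)
  next
    case False
    have mem: "submodule E N" "N \<subseteq> E" "I \<subseteq> N" "gv_set E F \<Longrightarrow> \<not> F \<subseteq> N" if "N \<in> C" for N F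
      using that C unfolding subset_chain_def \<A>_def by auto
    have lin: "N \<subseteq> N' \<or> N' \<subseteq> N" if "N \<in> C" "N' \<in> C" for N N'
      using that C unfolding subset_chain_def by auto
    have "x + y \<in> \<Union>C" if xy: "x \<in> \<Union>C" "y \<in> \<Union>C" for x y
    proof -
      obtain N N' where N: "N \<in> C" "x \<in> N" "N' \<in> C" "y \<in> N'" using xy by blast
      then obtain N where "N \<in> C" "x \<in> N" "y \<in> N" using lin[OF N(1,3)] by blast
      then show ?thesis using mem(1) unfolding submodule_def by blast
    qed
    moreover have "0 \<in> \<Union>C" "\<And>e x. e \<in> E \<Longrightarrow> x \<in> \<Union>C \<Longrightarrow> e * x \<in> \<Union>C"
      using mem(1) False unfolding submodule_def by blast+
    ultimately have "submodule E (\<Union>C)" unfolding submodule_def by blast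
    moreover have "\<not> F \<subseteq> \<Union>C" if F: "gv_set E F" for F
    proof
      assume "F \<subseteq> \<Union>C"
      moreover have "finite F" using F by (simp add: gv_set_def)
      ultimately obtain N where "N \<in> C" "F \<subseteq> N"
        using False C by (meson finite_subset_Union_chain)
      then show False using mem(4) F by blast
    qed
    ultimately have "\<Union>C \<in> \<A>" using mem False unfolding \<A>_def by blast
    then show ?thesis by blast
  qed
  then have "\<exists>M\<in>\<A>. \<forall>N\<in>\<A>. M \<subseteq> N \<longrightarrow> N = M" by (rule subset_Zorn)
  then obtain M where M: "M \<in> \<A>" and max: "\<And>N. N \<in> \<A> \<Longrightarrow> M \<subseteq> N \<Longrightarrow> N = M"
    by blast
  have sub: "submodule E M" "M \<subseteq> E" "I \<subseteq> M" and Mno: "\<And>F. gv_set E F \<Longrightarrow> \<not> F \<subseteq> M"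
    using M unfolding \<A>_def by blast+
  have closed: "x \<in> M" if x: "x \<in> E" and F: "gv_set E F" "\<forall>f\<in>F. x * f \<in> M" for x F
  proof (rule ccontr)
    assume xM: "x \<notin> M"
    note adjoin = adjoin_ideal[OF sub(1,2) x]
    obtain G where G: "gv_set E G" "G \<subseteq> adjoin M x"
      using max[of "adjoin M x"] adjoin xM sub(3) unfolding \<A>_def by blast
    have "f * g \<in> M" if f: "f \<in> F" and g: "g \<in> G" for f g
    proof -
      obtain i e where ie: "i \<in> M" "e \<in> E" "g = i + x * e" using g G unfolding adjoin_def by blast
      have "f \<in> E" using f F unfolding gv_set_def by blast
      then have "f * i + e * (x * f) \<in> M"
        using ie F(2) f by (auto intro!: submodule_add[OF sub(1) submodule_mult[OF sub(1)] submodule_mult[OF sub(1)]])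
      then show ?thesis by (simp add: ie algebra_simps)
    qed
    then have "(\<lambda>(f, g). f * g) ` (F \<times> G) \<subseteq> M" by auto
    then show False using Mno[OF gv_set_mult[OF F(1) G(1)]] by simp
  qed
  have "gv_set E {1}" using one_mem unfolding gv_set_def by auto
  then have "1 \<notin> M" using Mno by blast
  moreover have "M \<noteq> {0}" using I sub(3) unfolding submodule_def by blast
  ultimately have proper: "proper_w_ideal E M"
    unfolding proper_w_ideal_iff using sub closed by blast
  have "\<not> (\<exists>N. proper_w_ideal E N \<and> M \<subset> N)"
  proof
    assume "\<exists>N. proper_w_ideal E N \<and> M \<subset> N"
    then obtain N where N: "proper_w_ideal E N" "M \<subset> N" by blast
    have "N \<in> \<A>"
      unfolding \<A>_def using N sub proper_w_ideal_no_gv_set[OF N(1)] unfolding proper_w_ideal_iff by blast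
    then show False using max[of N] N by blast
  qed
  then show ?thesis using proper sub(3) unfolding maximal_w_ideal_def by blast
qed

text \<open>
  The larger ideal \<open>I\<close> need not be a \<open>w\<close>-ideal, but without a GV set it would lie in a maximal \<open>w\<close>-ideal.
\<close>

lemma gv_set_above_maximal_w_ideal:
  assumes M: "maximal_w_ideal E M" and I: "submodule E I" "I \<subseteq> E" "M \<subset> I"
  obtains F where "gv_set E F" "F \<subseteq> I"
proof -
  have "0 \<in> M" using M unfolding maximal_w_ideal_def proper_w_ideal_iff submodule_def by blast
  then have "I \<noteq> {0}" using I(3) by blast
  moreover have "\<not> (\<exists>N. maximal_w_ideal E N \<and> I \<subseteq> N)"
    using M I(3) unfolding maximal_w_ideal_def by blast
  ultimately show thesis using ex_maximal_w_ideal[OF I(1,2)] that by blast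
qed

lemma gv_set_adjoin:
  assumes M: "maximal_w_ideal E M" and x: "x \<in> E" "x \<notin> M"
  obtains F where "gv_set E F" "\<forall>f\<in>F. \<exists>i\<in>M. \<exists>e\<in>E. f = i + x * e"
proof -
  have sub: "submodule E M" "M \<subseteq> E"
    using M unfolding maximal_w_ideal_def proper_w_ideal_iff by auto
  note adjoin = adjoin_ideal[OF sub x(1)]
  then have "M \<subset> adjoin M x" using x(2) by blast
  then obtain F where "gv_set E F" "F \<subseteq> adjoin M x"
    using gv_set_above_maximal_w_ideal[OF M adjoin(1,2)] by blast
  then show thesis using that unfolding adjoin_def by blast
qed

text \<open>
  If \<open>xy \<in> M\<close> and \<open>x \<notin> M\<close>, then \<open>y\<close> multiplies a GV set in \<open>M + xE\<close> into \<open>M\<close>.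
\<close>

lemma maximal_w_ideal_prime:
  assumes M: "maximal_w_ideal E M"
  shows "prime_ideal_of E M"
proof -
  have sub: "submodule E M" "M \<subseteq> E" "1 \<notin> M"
    and closed: "\<And>x F. x \<in> E \<Longrightarrow> gv_set E F \<Longrightarrow> \<forall>f\<in>F. x * f \<in> M \<Longrightarrow> x \<in> M"
    using M unfolding maximal_w_ideal_def proper_w_ideal_iff by auto
  have "y \<in> M" if xy: "x \<in> E" "y \<in> E" "x * y \<in> M" "x \<notin> M" for x y
  proof -
    obtain F where F: "gv_set E F" "\<forall>f\<in>F. \<exists>i\<in>M. \<exists>e\<in>E. f = i + x * e"
      using gv_set_adjoin[OF M xy(1,4)] by blast
    have "y * f \<in> M" if "f \<in> F" for f
    proof -
      obtain i e where ie: "i \<in> M" "e \<in> E" "f = i + x * e" using F \<open>f \<in> F\<close> by blast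
      have "y * i + e * (x * y) \<in> M"
        using ie xy by (auto intro!: submodule_add[OF sub(1) submodule_mult[OF sub(1)] submodule_mult[OF sub(1)]])
      then show ?thesis by (simp add: ie algebra_simps)
    qed
    then show ?thesis using closed[OF xy(2) F(1)] by blast
  qed
  then show ?thesis
    using sub one_mem unfolding prime_ideal_of_def ideal_of_def by blast
qed

lemma prime_ideal_proper_w_ideal:
  assumes P: "prime_ideal_of E P" "P \<noteq> {0}" and no: "\<And>F. gv_set E F \<Longrightarrow> \<not> F \<subseteq> P"
  shows "proper_w_ideal E P"
proof -
  have "gv_set E {1}" using one_mem unfolding gv_set_def by auto
  then have "1 \<notin> P" using no by blast
  moreover have "x \<in> P" if "x \<in> E" "gv_set E F" "\<forall>f\<in>F. x * f \<in> P" for x F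
    using that P no[of F] unfolding prime_ideal_of_def gv_set_def by blast
  ultimately show ?thesis
    unfolding proper_w_ideal_iff using P unfolding prime_ideal_of_def ideal_of_def by blast
qed

end

section \<open>Domains given as types\<close>

text \<open>
  For a domain given as a type, membership of a fraction \<open>x / y\<close> in the domain is divisibility of \<open>x\<close>
  by \<open>y\<close>, so that GV sets and \<open>w\<close>-ideals can be described inside the domain.
\<close>

definition gv_idom :: "'a::idom set \<Rightarrow> bool" where
  "gv_idom F \<longleftrightarrow> gv_set (range to_fract) (to_fract ` F)"

lemma quotient_in_range_iff_dvd:
  assumes "y \<noteq> 0"
  shows "to_fract x / to_fract y \<in> range to_fract \<longleftrightarrow> y dvd x"
proof
  assume "to_fract x / to_fract y \<in> range to_fract"
  then obtain k where "to_fract x / to_fract y = to_fract k" by blast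
  then have "to_fract x = to_fract (k * y)" using assms by (simp add: field_simps)
  then show "y dvd x" by (metis dvd_triv_right to_fract_eq_iff)
next
  assume "y dvd x"
  then obtain k where "x = y * k" ..
  then have "to_fract x / to_fract y = to_fract k" using assms by simp
  then show "to_fract x / to_fract y \<in> range to_fract" by simp
qed

lemma gv_idom_iff:
  "gv_idom F \<longleftrightarrow>
     finite F \<and> \<not> F \<subseteq> {0} \<and> (\<forall>x y. y \<noteq> 0 \<longrightarrow> (\<forall>f\<in>F. y dvd x * f) \<longrightarrow> y dvd x)"
proof -
  have fin: "finite (to_fract ` F) \<longleftrightarrow> finite F"
    by (rule finite_image_iff) (simp add: inj_on_def)
  have nz: "to_fract ` F \<subseteq> {0} \<longleftrightarrow> F \<subseteq> {0}" by auto
  have quot: "(to_fract x / to_fract y) * to_fract f \<in> range to_fract \<longleftrightarrow> y dvd x * f"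
    if "y \<noteq> 0" for x y f :: 'a
    using quotient_in_range_iff_dvd[OF that, of "x * f"] by simp
  have "(\<forall>z. (\<forall>f\<in>to_fract ` F. z * f \<in> range to_fract) \<longrightarrow> z \<in> range to_fract) \<longleftrightarrow>
      (\<forall>x y. y \<noteq> 0 \<longrightarrow> (\<forall>f\<in>F. y dvd x * f) \<longrightarrow> y dvd x)" (is "?L \<longleftrightarrow> ?R")
  proof
    assume ?L
    show ?R
    proof (intro allI impI)
      fix x y :: 'a assume "y \<noteq> 0" "\<forall>f\<in>F. y dvd x * f"
      then have "\<forall>f\<in>to_fract ` F. (to_fract x / to_fract y) * f \<in> range to_fract"
        using quot by simp
      then have "to_fract x / to_fract y \<in> range to_fract" using \<open>?L\<close> by blast
      then show "y dvd x" using quotient_in_range_iff_dvd \<open>y \<noteq> 0\<close> by blast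
    qed
  next
    assume ?R
    show ?L
    proof (intro allI impI)
      fix z :: "'a fract" assume z: "\<forall>f\<in>to_fract ` F. z * f \<in> range to_fract"
      obtain x y where xy: "z = to_fract x / to_fract y" "y \<noteq> 0"
        by (metis Fract_conv_to_fract Fract_cases)
      then have "\<forall>f\<in>F. y dvd x * f" using z quot by simp
      then have "y dvd x" using \<open>?R\<close> xy(2) by blast
      then show "z \<in> range to_fract" using quotient_in_range_iff_dvd xy by blast
    qed
  qed
  moreover have "to_fract ` F \<subseteq> range to_fract" by blast
  ultimately show ?thesis
    by (simp only: gv_idom_def gv_set_def fin nz simp_thms)
qed

lemma gv_set_range_obtain:
  assumes "gv_set (range to_fract) G"
  obtains F where "G = to_fract ` F" "gv_idom F"
proof -
  obtain F where "G = to_fract ` F"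
    using assms unfolding gv_set_def by (meson subset_imageE)
  then show thesis using that assms unfolding gv_idom_def by blast
qed

lemma to_fract_image_mem_iff [simp]: "to_fract x \<in> to_fract ` M \<longleftrightarrow> x \<in> M"
  by auto

lemma submodule_to_fract_iff:
  "submodule (range to_fract) (to_fract ` M) \<longleftrightarrow> submodule UNIV M"
proof -
  have "(0 :: 'a fract) \<in> to_fract ` M \<longleftrightarrow> 0 \<in> M"
    using to_fract_image_mem_iff[of 0 M] by simp
  then show ?thesis
    unfolding submodule_def by (simp flip: to_fract_add to_fract_mult)
qed

lemma proper_w_ideal_to_fract_iff:
  "proper_w_ideal (range to_fract) (to_fract ` M) \<longleftrightarrow>
     submodule UNIV M \<and> M \<noteq> {0} \<and> 1 \<notin> M \<and>
     (\<forall>x F. gv_idom F \<longrightarrow> (\<forall>f\<in>F. x * f \<in> M) \<longrightarrow> x \<in> M)"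
proof -
  have 1: "(1 :: 'a fract) \<in> to_fract ` M \<longleftrightarrow> 1 \<in> M"
    using to_fract_image_mem_iff[of 1 M] by simp
  have 0: "to_fract ` M = {0} \<longleftrightarrow> M = {0}"
    using inj_image_eq_iff[of to_fract M "{0}"] by (simp add: inj_def)
  have "(\<forall>x\<in>range to_fract. \<forall>F. gv_set (range to_fract) F \<longrightarrow>
           (\<forall>f\<in>F. x * f \<in> to_fract ` M) \<longrightarrow> x \<in> to_fract ` M) \<longleftrightarrow>
        (\<forall>x F. gv_idom F \<longrightarrow> (\<forall>f\<in>F. x * f \<in> M) \<longrightarrow> x \<in> M)" (is "?L \<longleftrightarrow> ?R")
  proof
    assume ?L
    show ?R
    proof (intro allI impI)
      fix x F assume "gv_idom F" "\<forall>f\<in>F. x * f \<in> M"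
      then have "gv_set (range to_fract) (to_fract ` F)"
        "\<forall>f\<in>to_fract ` F. to_fract x * f \<in> to_fract ` M"
        by (auto simp: gv_idom_def simp flip: to_fract_mult)
      then have "to_fract x \<in> to_fract ` M" using \<open>?L\<close> by blast
      then show "x \<in> M" by simp
    qed
  next
    assume ?R
    show ?L
    proof (intro ballI allI impI)
      fix z G assume z: "z \<in> range to_fract" and G: "gv_set (range to_fract) G"
        and m: "\<forall>f\<in>G. z * f \<in> to_fract ` M"
      obtain F where F: "G = to_fract ` F" "gv_idom F" using gv_set_range_obtain[OF G] .
      obtain x where x: "z = to_fract x" using z by blast
      have "\<forall>f\<in>F. x * f \<in> M" using m by (simp add: F x flip: to_fract_mult)
      then show "z \<in> to_fract ` M" using \<open>?R\<close> F(2) x by blast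
    qed
  qed
  then show ?thesis
    unfolding proper_w_ideal_iff[OF range_to_fract_domain] submodule_to_fract_iff 0 1 by auto
qed

lemma proper_w_ideal_no_gv_idom:
  assumes "proper_w_ideal (range to_fract) (to_fract ` M)" "gv_idom F"
  shows "\<not> F \<subseteq> M"
  using assms unfolding proper_w_ideal_to_fract_iff by (metis mult_1 subsetD)

lemma maximal_w_ideal_idom_proper:
  "maximal_w_ideal_idom M \<Longrightarrow> proper_w_ideal (range to_fract) (to_fract ` M)"
  unfolding maximal_w_ideal_idom_def maximal_w_ideal_def by blast

lemma ex_maximal_w_ideal_idom:
  assumes I: "submodule UNIV I" "I \<noteq> {0}" and no: "\<And>F. gv_idom F \<Longrightarrow> \<not> F \<subseteq> I"
  shows "\<exists>M. maximal_w_ideal_idom M \<and> I \<subseteq> M"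
proof -
  have "\<exists>N. maximal_w_ideal (range to_fract) N \<and> to_fract ` I \<subseteq> N"
  proof (rule ex_maximal_w_ideal[OF range_to_fract_domain])
    show "submodule (range to_fract) (to_fract ` I)" using I submodule_to_fract_iff by blast
    show "to_fract ` I \<noteq> {0}"
      using I inj_image_eq_iff[of to_fract I "{0}"] by (simp add: inj_def)
    show "\<not> G \<subseteq> to_fract ` I" if "gv_set (range to_fract) G" for G
      using gv_set_range_obtain[OF that] no by (metis inj_image_subset_iff injI to_fract_eq_iff)
  qed auto
  then obtain N where N: "maximal_w_ideal (range to_fract) N" "to_fract ` I \<subseteq> N" by blast
  then have "N \<subseteq> range to_fract"
    unfolding maximal_w_ideal_def proper_w_ideal_def by blast
  then obtain M where "N = to_fract ` M" by (meson subset_imageE)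
  moreover have "I \<subseteq> M" using N(2) calculation by auto
  ultimately show ?thesis using N(1) unfolding maximal_w_ideal_idom_def by blast
qed

lemma gv_idom_adjoin:
  assumes M: "maximal_w_ideal_idom M" and x: "x \<notin> M"
  obtains F where "gv_idom F" "\<forall>f\<in>F. \<exists>i\<in>M. \<exists>e. f = i + x * e"
proof -
  obtain G where G: "gv_set (range to_fract) G"
    and Ge: "\<forall>g\<in>G. \<exists>i\<in>to_fract ` M. \<exists>e\<in>range to_fract. g = i + to_fract x * e"
    by (rule gv_set_adjoin[OF range_to_fract_domain M[unfolded maximal_w_ideal_idom_def], of "to_fract x"])
      (use x in auto)
  obtain F where F: "G = to_fract ` F" "gv_idom F" using gv_set_range_obtain[OF G] .
  have "\<forall>f\<in>F. \<exists>i\<in>M. \<exists>e. f = i + x * e"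
    using Ge unfolding F(1) by (simp flip: to_fract_add to_fract_mult)
  then show thesis using that F(2) by blast
qed

lemma prime_ideal_to_fract:
  assumes "prime_ideal_of (range to_fract) (to_fract ` M)"
  shows "prime_ideal_of UNIV M"
proof -
  have "M \<noteq> UNIV" using assms unfolding prime_ideal_of_def by blast
  then show ?thesis
    using assms unfolding prime_ideal_of_def ideal_of_def submodule_to_fract_iff
    by (simp flip: to_fract_mult)
qed

lemma maximal_w_ideal_idom_prime:
  "maximal_w_ideal_idom M \<Longrightarrow> prime_ideal_of UNIV M"
  unfolding maximal_w_ideal_idom_def
  by (intro prime_ideal_to_fract maximal_w_ideal_prime range_to_fract_domain)

section \<open>Contents of polynomials and GV sets\<close>

lemma const_dvd_const_times_iff:
  "[:b:] dvd [:a:] * h \<longleftrightarrow> (\<forall>n. b dvd coeff h n * a)" for b :: "'a::idom"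
  by (simp add: const_poly_dvd_iff mult.commute)

text \<open>
  Read \<open>h / b\<close> as a polynomial \<open>u\<close> over the quotient field. The claim is that \<open>u\<close> has coefficients in
  the domain if \<open>Bu\<close> and \<open>gu\<close> do and if the condition \<open>closed\<close> holds, which says that an element of the quotient
  field that \<open>B\<close> and all coefficients of \<open>g\<close> multiply into the domain lies in the domain. The
  Dedekind-Mertens lemma would give this with powers of the content of \<open>g\<close>; letting \<open>B\<close> vary avoids
  them. The induction is on the length of \<open>g\<close>, and for fixed \<open>g\<close> on the length of \<open>h\<close>. Let \<open>a\<close> be the
  top coefficient of \<open>g\<close>. The top coefficient of \<open>gu\<close> is \<open>a\<close> times that of \<open>u\<close>, so \<open>au\<close> without its top
  term satisfies the hypotheses again and is shorter than \<open>u\<close>; by induction \<open>au\<close> has coefficients in the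
  domain. Now \<open>a\<close> can be moved from \<open>g\<close> into \<open>B\<close>, which leaves \<open>closed\<close> true and shortens \<open>g\<close>.
\<close>

lemma const_dvd_of_content_closed:
  fixes b :: "'a::idom"
  assumes closed: "\<And>x. \<forall>a\<in>B. b dvd x * a \<Longrightarrow> \<forall>n. b dvd x * coeff g n \<Longrightarrow> b dvd x"
    and "\<forall>a\<in>B. [:b:] dvd [:a:] * h" "[:b:] dvd h * g"
  shows "[:b:] dvd h"
proof -
  have main: "[:b:] dvd h"
    if "\<forall>i\<ge>n. coeff g i = 0"
      "\<forall>x. (\<forall>a\<in>B. b dvd x * a) \<longrightarrow> (\<forall>n. b dvd x * coeff g n) \<longrightarrow> b dvd x"
      "\<forall>a\<in>B. [:b:] dvd [:a:] * h" "[:b:] dvd h * g" for n g B h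
    using that
  proof (induction n arbitrary: g B h)
    case 0
    then have "g = 0" by (simp add: poly_eq_iff)
    have "b dvd coeff h k" for k
    proof -
      have "\<forall>a\<in>B. b dvd coeff h k * a"
        using 0(3) unfolding const_dvd_const_times_iff by blast
      moreover have "\<forall>j. b dvd coeff h k * coeff g j" using \<open>g = 0\<close> by simp
      ultimately show ?thesis using 0(2) by blast
    qed
    then show ?case unfolding const_poly_dvd_iff by blast
  next
    case (Suc n)
    note g_top = Suc.prems(1) and closed = Suc.prems(2) and outer = Suc.IH
    define a where "a = coeff g n"
    define g' where "g' = g - monom a n"
    have monom_a: "monom a n = [:a:] * monom 1 n" by (simp add: smult_monom)
    have closed': "\<forall>x. (\<forall>d\<in>insert a B. b dvd x * d) \<longrightarrow> (\<forall>k. b dvd x * coeff g' k) \<longrightarrow> b dvd x"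
    proof (intro allI impI)
      fix x assume x: "\<forall>d\<in>insert a B. b dvd x * d" "\<forall>k. b dvd x * coeff g' k"
      have "b dvd x * coeff g k" for k
        using x(1) x(2)[rule_format, of k] by (cases "k = n") (auto simp: a_def g'_def)
      then show "b dvd x" using closed x(1) by blast
    qed
    have g'_top: "\<forall>i\<ge>n. coeff g' i = 0"
    proof (intro allI impI)
      fix i assume "n \<le> i"
      then show "coeff g' i = 0"
        using g_top by (cases "i = n") (auto simp: g'_def a_def)
    qed
    have inner: "[:b:] dvd h"
      if "\<forall>j\<ge>m. coeff h j = 0" "\<forall>a\<in>B. [:b:] dvd [:a:] * h" "[:b:] dvd h * g" for m h
      using that
    proof (induction m arbitrary: h)
      case 0
      then have "h = 0" by (simp add: poly_eq_iff)
      then show ?case by simp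
    next
      case (Suc m)
      define c where "c = coeff h m"
      have "coeff (h * g) (m + n) = (\<Sum>i\<in>{m}. coeff h i * coeff g (m + n - i))"
        unfolding coeff_mult
      proof (rule sum.mono_neutral_right)
        show "\<forall>i\<in>{..m + n} - {m}. coeff h i * coeff g (m + n - i) = 0"
        proof
          fix i assume "i \<in> {..m + n} - {m}"
          then have "i \<ge> Suc m \<or> m + n - i \<ge> Suc n" by auto
          then show "coeff h i * coeff g (m + n - i) = 0"
            using Suc.prems(1) g_top by auto
        qed
      qed auto
      then have "coeff (h * g) (m + n) = c * a" by (simp add: a_def c_def)
      then have "b dvd c * a"
        using Suc.prems(3) unfolding const_poly_dvd_iff by metis
      then have top: "[:b:] dvd monom (a * c) m"
        by (simp add: const_poly_dvd_iff mult.commute)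
      \<comment> \<open>\<open>a * h\<close> without its top term, which \<open>b\<close> divides\<close>
      define h' where "h' = [:a:] * h - monom (a * c) m"
      have "[:b:] dvd h'"
      proof (rule Suc.IH)
        show "\<forall>j\<ge>m. coeff h' j = 0"
        proof (intro allI impI)
          fix j assume "m \<le> j"
          then show "coeff h' j = 0"
            using Suc.prems(1) by (cases "j = m") (auto simp: h'_def c_def)
        qed
        show "\<forall>a\<in>B. [:b:] dvd [:a:] * h'"
        proof
          fix d assume "d \<in> B"
          then have "[:b:] dvd [:a:] * ([:d:] * h) - [:d:] * monom (a * c) m"
            using Suc.prems(2) by (intro dvd_diff[OF dvd_mult dvd_mult[OF top]]) blast
          then show "[:b:] dvd [:d:] * h'" by (simp only: h'_def algebra_simps)
        qed
        have "[:b:] dvd [:a:] * (h * g) - g * monom (a * c) m"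
          by (intro dvd_diff[OF dvd_mult dvd_mult[OF top]] Suc.prems(3))
        then show "[:b:] dvd h' * g" by (simp only: h'_def algebra_simps)
      qed
      then have ah: "[:b:] dvd [:a:] * h"
        using dvd_add[OF _ top, of h'] unfolding h'_def by simp
      show ?case
      proof (rule outer[OF g'_top closed'])
        show "\<forall>d\<in>insert a B. [:b:] dvd [:d:] * h" using ah Suc.prems(2) by blast
        have "[:b:] dvd h * g - ([:a:] * h) * monom 1 n"
          by (intro dvd_diff[OF _ dvd_mult2] ah Suc.prems(3))
        then show "[:b:] dvd h * g'"
          by (simp only: g'_def monom_a algebra_simps)
      qed
    qed
    show ?case
      by (rule inner[of "Suc (degree h)"]) (use Suc.prems in \<open>auto simp: coeff_eq_0\<close>)
  qed
  have top: "\<forall>i\<ge>Suc (degree g). coeff g i = 0" by (simp add: coeff_eq_0)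
  have "\<forall>x. (\<forall>a\<in>B. b dvd x * a) \<longrightarrow> (\<forall>n. b dvd x * coeff g n) \<longrightarrow> b dvd x"
    using closed by blast
  from main[OF top this assms(2,3)] show ?thesis .
qed

text \<open>
  If a fraction \<open>x / y\<close> multiplies \<open>b\<close> into \<open>D[X]\<close>, then it equals \<open>h / b\<close> with \<open>h \<in> D[X]\<close>, so it is a
  polynomial over the quotient field of \<open>D\<close> and the previous lemma applies to it.
\<close>

lemma gv_idom_const_polys_insert:
  fixes B :: "'a::idom set"
  assumes B: "finite B" "b \<in> B" "b \<noteq> 0"
    and closed: "\<And>x y. y \<noteq> 0 \<Longrightarrow> \<forall>a\<in>B. y dvd x * a \<Longrightarrow> \<forall>n. y dvd x * coeff g n \<Longrightarrow> y dvd x"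
  shows "gv_idom (insert g (const_poly ` B))"
  unfolding gv_idom_iff
proof (intro conjI allI impI)
  show "finite (insert g (const_poly ` B))" using B by simp
  show "\<not> insert g (const_poly ` B) \<subseteq> {0}" using B by (auto simp: const_poly_def)
  fix x y :: "'a poly"
  assume y: "y \<noteq> 0" and dvd: "\<forall>f\<in>insert g (const_poly ` B). y dvd x * f"
  have mult: "y dvd x * [:a:]" if "a \<in> B" for a
    using dvd that unfolding const_poly_def by blast
  then obtain h where h: "x * [:b:] = y * h" using B(2) by (meson dvdE)
  have cancel: "[:b:] dvd h * f" if "y dvd x * f" for f
  proof -
    obtain k where k: "x * f = y * k" using \<open>y dvd x * f\<close> ..
    have "y * (h * f) = (x * [:b:]) * f" by (simp only: h mult.assoc)
    also have "\<dots> = (x * f) * [:b:]" by (simp only: mult_ac)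
    also have "\<dots> = y * (k * [:b:])" by (simp only: k mult.assoc)
    finally have "h * f = k * [:b:]" using y by (metis mult_cancel_left)
    then show ?thesis by (metis dvd_triv_right)
  qed
  have "[:b:] dvd h"
  proof (rule const_dvd_of_content_closed)
    show "b dvd z" if "\<forall>a\<in>B. b dvd z * a" "\<forall>n. b dvd z * coeff g n" for z
      using closed[OF B(3) that] .
    show "\<forall>a\<in>B. [:b:] dvd [:a:] * h"
      using cancel[OF mult] by (metis mult.commute)
    show "[:b:] dvd h * g" using cancel dvd by blast
  qed
  then obtain k where "h = [:b:] * k" ..
  then have "x * [:b:] = (y * k) * [:b:]" by (simp only: h mult_ac)
  then have "x = y * k" using B(3) by (metis mult_cancel_right pCons_eq_0_iff)
  then show "y dvd x" by simp
qed

section \<open>Ideals of polynomials with coefficients in an ideal\<close>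

definition coeffs_in :: "'a::zero set \<Rightarrow> 'a poly set" where
  "coeffs_in M = {f. \<forall>n. coeff f n \<in> M}"

lemma const_poly_in_coeffs_in:
  assumes "0 \<in> M" "a \<in> M"
  shows "const_poly a \<in> coeffs_in M"
  using assms by (auto simp: coeffs_in_def const_poly_def coeff_pCons split: nat.split)

text \<open>
  The polynomials that supply the elements of \<open>F\<close> are shifted by powers of \<open>X\<close> so far apart that their
  coefficients do not overlap, and then added.
\<close>

lemma ex_poly_collecting_coeffs:
  fixes q :: "'a::idom poly set"
  assumes q: "submodule UNIV q" and "finite F" "F \<subseteq> {coeff f n | f n. f \<in> q}"
  shows "\<exists>g\<in>q. F \<subseteq> range (coeff g)"
  using assms(2,3)
proof (induction F rule: finite_induct)
  case empty
  then show ?case using submodule_zero[OF q] by blast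
next
  case (insert a F)
  then obtain g where g: "g \<in> q" "F \<subseteq> range (coeff g)" by blast
  obtain f n where f: "f \<in> q" "a = coeff f n" using insert.prems by blast
  define N where "N = Suc (degree g)"
  define h where "h = g + monom 1 N * f"
  have hq: "h \<in> q"
    unfolding h_def using g(1) f(1) by (intro submodule_add[OF q] submodule_mult[OF q]) auto
  have low: "coeff h i = coeff g i" if "i < N" for i
    using that by (simp add: h_def coeff_monom_mult)
  have "coeff h (n + N) = a"
    by (simp add: h_def coeff_monom_mult f N_def coeff_eq_0)
  moreover have "F \<subseteq> range (coeff h)"
  proof
    fix c assume "c \<in> F"
    then obtain i where i: "c = coeff g i" using g(2) by blast
    show "c \<in> range (coeff h)"
    proof (cases "i < N")
      case True
      then show ?thesis using i low by (metis rangeI)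
    next
      case False
      then have "c = 0" using i by (simp add: N_def coeff_eq_0)
      moreover have "coeff h (Suc (degree h)) = 0" by (simp add: coeff_eq_0)
      ultimately show ?thesis by (metis rangeI)
    qed
  qed
  ultimately show ?case using hq by blast
qed

text \<open>
  The coefficients of the elements of \<open>q\<close> form an ideal \<open>I\<close> of \<open>D\<close>. It contains no GV set \<open>F\<close>: otherwise \<open>F\<close>
  would consist of coefficients of a single \<open>g \<in> q\<close>, and \<open>{b, g}\<close> would be a GV set in \<open>q\<close>. So \<open>I\<close> lies
  in a maximal \<open>w\<close>-ideal.
\<close>

lemma ideal_subset_coeffs_in_maximal:
  fixes q :: "'a::idom poly set"
  assumes q: "submodule UNIV q" and b: "const_poly b \<in> q" "b \<noteq> 0"
    and no: "\<And>F. gv_idom F \<Longrightarrow> \<not> F \<subseteq> q"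
  shows "\<exists>M. maximal_w_ideal_idom M \<and> q \<subseteq> coeffs_in M"
proof -
  define I where "I = {coeff f n | f n. f \<in> q}"
  have I: "coeff f n \<in> I" if "f \<in> q" for f n using that unfolding I_def by blast
  have "submodule UNIV I"
    unfolding submodule_def
  proof (intro conjI ballI)
    show "0 \<in> I" using I[OF submodule_zero[OF q], of 0] by simp
    show "x + y \<in> I" if xy: "x \<in> I" "y \<in> I" for x y
    proof -
      obtain f n g k where *: "x = coeff f n" "f \<in> q" "y = coeff g k" "g \<in> q"
        using xy unfolding I_def by blast
      have "monom 1 k * f + monom 1 n * g \<in> q"
        using * by (intro submodule_add[OF q] submodule_mult[OF q]) auto
      from I[OF this, of "n + k"] show ?thesis by (simp add: * coeff_monom_mult)
    qed
    show "e * x \<in> I" if x: "x \<in> I" for e x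
    proof -
      obtain f n where *: "x = coeff f n" "f \<in> q" using x unfolding I_def by blast
      have "[:e:] * f \<in> q" using * by (intro submodule_mult[OF q]) auto
      from I[OF this, of n] show ?thesis by (simp add: *)
    qed
  qed
  moreover have "b \<in> I" using I[OF b(1), of 0] by (simp add: const_poly_def)
  then have "I \<noteq> {0}" using b(2) by blast
  moreover have "\<not> F \<subseteq> I" if F: "gv_idom F" for F
  proof
    assume "F \<subseteq> I"
    then obtain g where g: "g \<in> q" "F \<subseteq> range (coeff g)"
      using ex_poly_collecting_coeffs[OF q, of F] F unfolding gv_idom_iff I_def by blast
    have "gv_idom (insert g (const_poly ` {b}))"
    proof (rule gv_idom_const_polys_insert[where b = b])
      fix x y :: 'a assume "y \<noteq> 0" and *: "\<forall>n. y dvd x * coeff g n"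
      have "\<forall>f\<in>F. y dvd x * f"
      proof
        fix f assume "f \<in> F"
        then obtain n where "f = coeff g n" using g(2) by blast
        then show "y dvd x * f" using * by simp
      qed
      then show "y dvd x" using F \<open>y \<noteq> 0\<close> unfolding gv_idom_iff by blast
    qed (use b in auto)
    then show False using no g(1) b(1) by blast
  qed
  ultimately obtain M where "maximal_w_ideal_idom M" "I \<subseteq> M"
    using ex_maximal_w_ideal_idom by blast
  then show ?thesis using I unfolding coeffs_in_def by blast
qed

lemma prime_ideal_coeffs_in:
  fixes M :: "'a::idom set"
  assumes M: "prime_ideal_of UNIV M"
  shows "prime_ideal_of UNIV (coeffs_in M)"
proof -
  have sub: "submodule UNIV M" and ne: "M \<noteq> UNIV"
    and prime: "\<And>x y. x * y \<in> M \<Longrightarrow> x \<in> M \<or> y \<in> M"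
    using M unfolding prime_ideal_of_def ideal_of_def by auto
  have sum: "sum h A \<in> M" if "\<And>i. i \<in> A \<Longrightarrow> h i \<in> M" for h and A :: "nat set"
    using that by (induction A rule: infinite_finite_induct)
      (auto intro: submodule_zero[OF sub] submodule_add[OF sub])
  have multr: "x * e \<in> M" if "x \<in> M" for x e
    using submodule_mult[OF sub, of e x] that by (simp add: mult.commute)
  have minus: "x \<in> M" if "x + y \<in> M" "y \<in> M" for x y
    using submodule_add[OF sub that(1) submodule_mult[OF sub, of "-1" y]] that by simp
  have "submodule UNIV (coeffs_in M)"
    unfolding submodule_def coeffs_in_def
    by (auto simp: coeff_mult intro!: submodule_zero[OF sub] submodule_add[OF sub] sum
        submodule_mult[OF sub])
  moreover have "coeffs_in M \<noteq> UNIV"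
  proof -
    obtain c where "c \<notin> M" using ne by blast
    then have "[:c:] \<notin> coeffs_in M" unfolding coeffs_in_def by (auto intro!: exI[of _ 0])
    then show ?thesis by blast
  qed
  moreover have "f \<in> coeffs_in M \<or> g \<in> coeffs_in M" if fg: "f * g \<in> coeffs_in M" for f g
  proof (rule ccontr)
    assume "\<not> ?thesis"
    then have ex: "\<exists>i. coeff f i \<notin> M" "\<exists>j. coeff g j \<notin> M" unfolding coeffs_in_def by auto
    define i where "i = (LEAST i. coeff f i \<notin> M)"
    define j where "j = (LEAST j. coeff g j \<notin> M)"
    have ij: "coeff f i \<notin> M" "coeff g j \<notin> M"
      unfolding i_def j_def using LeastI_ex[OF ex(1)] LeastI_ex[OF ex(2)] by blast+
    have low: "k < i \<Longrightarrow> coeff f k \<in> M" "k < j \<Longrightarrow> coeff g k \<in> M" for k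
      unfolding i_def j_def using not_less_Least by blast+
    \<comment> \<open>modulo \<open>M\<close>, the lowest coefficient of the product is the product of the lowest coefficients\<close>
    have "coeff (f * g) (i + j) =
        coeff f i * coeff g j + (\<Sum>k\<in>{..i + j} - {i}. coeff f k * coeff g (i + j - k))"
      unfolding coeff_mult by (subst sum.remove[of _ i]) auto
    moreover have "(\<Sum>k\<in>{..i + j} - {i}. coeff f k * coeff g (i + j - k)) \<in> M"
    proof (rule sum)
      fix k assume "k \<in> {..i + j} - {i}"
      then have "k < i \<or> i + j - k < j" by auto
      then show "coeff f k * coeff g (i + j - k) \<in> M"
        using low multr submodule_mult[OF sub] by blast
    qed
    moreover have "coeff (f * g) (i + j) \<in> M" using fg unfolding coeffs_in_def by blast
    ultimately have "coeff f i * coeff g j \<in> M" using minus by metis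
    then show False using prime ij by blast
  qed
  ultimately show ?thesis unfolding prime_ideal_of_def ideal_of_def by blast
qed

section \<open>Extension to and contraction from the Anderson ring\<close>

lemma anderson_one: "1 \<in> anderson_set"
  and anderson_mult: "s \<in> anderson_set \<Longrightarrow> t \<in> anderson_set \<Longrightarrow> s * t \<in> anderson_set"
  and anderson_nonzero: "s \<in> anderson_set \<Longrightarrow> to_fract s \<noteq> 0"
  unfolding anderson_set_def by auto

lemma anderson_ring_fraction: "s \<in> anderson_set \<Longrightarrow> to_fract f / to_fract s \<in> anderson_ring"
  unfolding anderson_ring_def by blast

lemma to_fract_in_anderson_ring: "to_fract f \<in> anderson_ring"
  using anderson_ring_fraction[OF anderson_one, of f] by simp

lemma mem_extend_poly_iff:
  assumes P: "submodule UNIV P"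
  shows "x \<in> extend_poly P \<longleftrightarrow> (\<exists>f\<in>P. \<exists>s\<in>anderson_set. x = to_fract f / to_fract s)"
proof
  define N where "N = {to_fract f / to_fract s | f s. f \<in> P \<and> s \<in> anderson_set}"
  have N: "to_fract f / to_fract s \<in> N" if "f \<in> P" "s \<in> anderson_set" for f s
    using that unfolding N_def by blast
  have inc: "to_fract f \<in> N" if "f \<in> P" for f
    using N[OF that anderson_one] by simp
  have "submodule anderson_ring N"
    unfolding submodule_def
  proof (intro conjI ballI)
    show "0 \<in> N" using inc[OF submodule_zero[OF P]] by simp
    show "x + y \<in> N" if xy: "x \<in> N" "y \<in> N" for x y
    proof -
      obtain f s g t where *: "x = to_fract f / to_fract s" "f \<in> P" "s \<in> anderson_set"
        "y = to_fract g / to_fract t" "g \<in> P" "t \<in> anderson_set"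
        using xy unfolding N_def by blast
      have "t * f + s * g \<in> P"
        using * by (intro submodule_add[OF P] submodule_mult[OF P]) auto
      from N[OF this anderson_mult[OF *(3,6)]] show ?thesis
        using anderson_nonzero[OF *(3)] anderson_nonzero[OF *(6)]
        by (simp add: * add_frac_eq mult.commute)
    qed
    show "e * x \<in> N" if ex: "e \<in> anderson_ring" "x \<in> N" for e x
    proof -
      obtain f s g t where *: "x = to_fract f / to_fract s" "f \<in> P" "s \<in> anderson_set"
        "e = to_fract g / to_fract t" "t \<in> anderson_set"
        using ex unfolding N_def anderson_ring_def by blast
      have "g * f \<in> P" using * by (intro submodule_mult[OF P]) auto
      from N[OF this anderson_mult[OF *(5,3)]] show ?thesis by (simp add: *)
    qed
  qed
  then have "extend_poly P \<subseteq> N"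
    unfolding extend_poly_def using inc by (intro gen_least) auto
  then show "x \<in> extend_poly P \<Longrightarrow> \<exists>f\<in>P. \<exists>s\<in>anderson_set. x = to_fract f / to_fract s"
    unfolding N_def by blast
next
  assume "\<exists>f\<in>P. \<exists>s\<in>anderson_set. x = to_fract f / to_fract s"
  then obtain f s where *: "f \<in> P" "s \<in> anderson_set" "x = to_fract f / to_fract s" by blast
  have "to_fract f \<in> extend_poly P"
    unfolding extend_poly_def using gen_superset *(1) by blast
  then have "to_fract 1 / to_fract s * to_fract f \<in> extend_poly P"
    unfolding extend_poly_def by (intro submodule_mult[OF submodule_gen] anderson_ring_fraction *(2))
  then show "x \<in> extend_poly P" by (simp add: *(3))
qed

lemma submodule_extend_poly: "submodule anderson_ring (extend_poly P)"
  unfolding extend_poly_def by (rule submodule_gen)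

lemma extend_poly_mono: "P \<subseteq> Q \<Longrightarrow> extend_poly P \<subseteq> extend_poly Q"
  unfolding extend_poly_def
  by (intro gen_least submodule_gen order_trans[OF image_mono gen_superset])

lemma extend_base_eq:
  assumes M: "submodule UNIV M"
  shows "extend_base M = extend_poly (coeffs_in M)"
proof
  have "(\<lambda>a. to_fract (const_poly a)) ` M \<subseteq> to_fract ` coeffs_in M"
    using const_poly_in_coeffs_in[OF submodule_zero[OF M]] by auto
  also have "\<dots> \<subseteq> extend_poly (coeffs_in M)"
    unfolding extend_poly_def by (rule gen_superset)
  finally show "extend_base M \<subseteq> extend_poly (coeffs_in M)"
    unfolding extend_base_def by (rule gen_least[OF _ submodule_extend_poly])
next
  have sub: "submodule anderson_ring (extend_base M)"
    unfolding extend_base_def by (rule submodule_gen)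
  have const: "to_fract [:a:] \<in> extend_base M" if "a \<in> M" for a
    using that gen_superset[of "(\<lambda>a. to_fract (const_poly a)) ` M"]
    unfolding extend_base_def const_poly_def by blast
  have "to_fract f \<in> extend_base M" if "\<forall>n. coeff f n \<in> M" for f
    using that
  proof (induction f)
    case 0
    then show ?case using submodule_zero[OF sub] by simp
  next
    case (pCons a f)
    have "a \<in> M" using spec[OF pCons.prems, of 0] by simp
    moreover have "\<forall>n. coeff f n \<in> M" using pCons.prems by (metis coeff_pCons_Suc)
    ultimately have "to_fract [:a:] + to_fract [:0, 1:] * to_fract f \<in> extend_base M"
      using const pCons.IH
      by (intro submodule_add[OF sub] submodule_mult[OF sub to_fract_in_anderson_ring]) auto
    then show ?case by (simp flip: to_fract_add to_fract_mult)
  qed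
  then show "extend_poly (coeffs_in M) \<subseteq> extend_base M"
    unfolding extend_poly_def coeffs_in_def by (intro gen_least sub) auto
qed

lemma to_fract_in_extend_poly_iff:
  assumes P: "prime_ideal_of UNIV P" "P \<inter> anderson_set = {}"
  shows "to_fract f \<in> extend_poly P \<longleftrightarrow> f \<in> P"
proof
  have sub: "submodule UNIV P" using P unfolding prime_ideal_of_def ideal_of_def by blast
  show "to_fract f \<in> extend_poly P" if "f \<in> P"
    unfolding extend_poly_def using gen_superset that by blast
  assume "to_fract f \<in> extend_poly P"
  then obtain g s where *: "g \<in> P" "s \<in> anderson_set" "to_fract f = to_fract g / to_fract s"
    unfolding mem_extend_poly_iff[OF sub] by blast
  then have "to_fract (f * s) = to_fract g" using anderson_nonzero[OF *(2)] by simp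
  then have "f * s \<in> P" using * by (metis to_fract_eq_iff)
  then show "f \<in> P" using P *(2) unfolding prime_ideal_of_def by blast
qed

lemma prime_ideal_extend_poly:
  assumes P: "prime_ideal_of UNIV P" "P \<inter> anderson_set = {}"
  shows "prime_ideal_of anderson_ring (extend_poly P)"
proof -
  have sub: "submodule UNIV P" using P unfolding prime_ideal_of_def ideal_of_def by blast
  have "extend_poly P \<subseteq> anderson_ring"
    unfolding subset_iff mem_extend_poly_iff[OF sub] using anderson_ring_fraction by blast
  moreover have "1 \<notin> extend_poly P"
    using to_fract_in_extend_poly_iff[OF P, of 1] P(2) anderson_one by auto
  then have "extend_poly P \<noteq> anderson_ring"
    using to_fract_in_anderson_ring[of 1] by auto
  moreover have "x \<in> extend_poly P \<or> y \<in> extend_poly P"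
    if xy: "x \<in> anderson_ring" "y \<in> anderson_ring" "x * y \<in> extend_poly P" for x y
  proof -
    obtain f s g t where *: "x = to_fract f / to_fract s" "s \<in> anderson_set"
      "y = to_fract g / to_fract t" "t \<in> anderson_set"
      using xy(1,2) unfolding anderson_ring_def by blast
    have "to_fract (s * t) * (x * y) \<in> extend_poly P"
      by (intro submodule_mult[OF submodule_extend_poly] to_fract_in_anderson_ring xy(3))
    moreover have "to_fract (s * t) * (x * y) = to_fract (f * g)"
      using anderson_nonzero[OF *(2)] anderson_nonzero[OF *(4)] by (simp add: *)
    ultimately have "to_fract (f * g) \<in> extend_poly P" by metis
    then have "f * g \<in> P" unfolding to_fract_in_extend_poly_iff[OF P] .
    then have "f \<in> P \<or> g \<in> P" using P unfolding prime_ideal_of_def by blast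
    then show ?thesis unfolding mem_extend_poly_iff[OF sub] using * by blast
  qed
  ultimately show ?thesis
    unfolding prime_ideal_of_def ideal_of_def using submodule_extend_poly by blast
qed

lemma submodule_contraction:
  assumes m: "submodule anderson_ring m"
  shows "submodule UNIV {f. to_fract f \<in> m}"
  unfolding submodule_def
  using submodule_zero[OF m] submodule_add[OF m] submodule_mult[OF m to_fract_in_anderson_ring]
  by auto

lemma extend_contraction:
  assumes m: "submodule anderson_ring m" "m \<subseteq> anderson_ring"
  shows "extend_poly {f. to_fract f \<in> m} = m"
proof
  show "extend_poly {f. to_fract f \<in> m} \<subseteq> m"
    unfolding extend_poly_def by (intro gen_least m) auto
  show "m \<subseteq> extend_poly {f. to_fract f \<in> m}"
  proof
    fix x assume x: "x \<in> m"
    then obtain f s where *: "x = to_fract f / to_fract s" "s \<in> anderson_set"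
      using m(2) unfolding anderson_ring_def by blast
    have "to_fract s * x \<in> m"
      by (intro submodule_mult[OF m(1)] to_fract_in_anderson_ring x)
    then have "to_fract f \<in> m" using anderson_nonzero[OF *(2)] by (simp add: *)
    then show "x \<in> extend_poly {f. to_fract f \<in> m}"
      unfolding mem_extend_poly_iff[OF submodule_contraction[OF m(1)]] using * by blast
  qed
qed

lemma prime_ideal_contraction:
  assumes m: "prime_ideal_of anderson_ring m"
  shows "prime_ideal_of UNIV {f. to_fract f \<in> m}"
proof -
  have sub: "submodule anderson_ring m" "m \<subseteq> anderson_ring" "m \<noteq> anderson_ring"
    using m unfolding prime_ideal_of_def ideal_of_def by auto
  have "1 \<notin> m" using sub submodule_mult[OF sub(1), of _ 1] by auto
  then have "{f. to_fract f \<in> m} \<noteq> UNIV" by (metis (mono_tags) UNIV_I mem_Collect_eq to_fract_1)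
  then show ?thesis
    using m submodule_contraction[OF sub(1)] to_fract_in_anderson_ring
    unfolding prime_ideal_of_def ideal_of_def by auto
qed

lemma common_denominator:
  assumes P: "submodule UNIV P" and "finite F" "F \<subseteq> extend_poly P"
  shows "\<exists>s\<in>anderson_set. \<forall>x\<in>F. to_fract s * x \<in> to_fract ` P"
  using assms(2,3)
proof (induction F rule: finite_induct)
  case empty
  then show ?case using anderson_one by blast
next
  case (insert y F)
  then obtain s where s: "s \<in> anderson_set" "\<forall>x\<in>F. to_fract s * x \<in> to_fract ` P" by blast
  obtain g t where t: "g \<in> P" "t \<in> anderson_set" "y = to_fract g / to_fract t"
    using insert.prems mem_extend_poly_iff[OF P] by blast
  have "to_fract (s * t) * x \<in> to_fract ` P" if "x \<in> insert y F" for x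
  proof (cases "x = y")
    case True
    then have "to_fract (s * t) * x = to_fract (s * g)"
      using anderson_nonzero[OF t(2)] by (simp add: t(3))
    then show ?thesis using submodule_mult[OF P UNIV_I t(1)] by (metis imageI)
  next
    case False
    then obtain f where "f \<in> P" "to_fract s * x = to_fract f" using s \<open>x \<in> insert y F\<close> by blast
    then have "to_fract (s * t) * x = to_fract (t * f)" by (simp add: mult.left_commute mult.commute)
    then show ?thesis using submodule_mult[OF P UNIV_I \<open>f \<in> P\<close>] by (metis imageI)
  qed
  then show ?case using anderson_mult[OF s(1) t(2)] by blast
qed

lemma extend_poly_UNIV: "extend_poly UNIV = anderson_ring"
proof -
  have "submodule UNIV UNIV" by (simp add: submodule_def)
  from mem_extend_poly_iff[OF this] show ?thesis unfolding anderson_ring_def by blast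
qed

text \<open>
  Over the common denominator \<open>s\<close> of the finitely many products \<open>xf\<close>, the condition on \<open>x\<close> becomes
  the condition on \<open>sx\<close> in \<open>D[X]\<close>.
\<close>

lemma gv_idom_anderson:
  assumes F: "gv_idom F"
  shows "gv_set anderson_ring (to_fract ` F)"
  unfolding gv_set_def
proof (intro conjI allI impI)
  have F': "finite F" "\<not> F \<subseteq> {0}" using F unfolding gv_idom_iff by auto
  show "finite (to_fract ` F)" using F' by simp
  show "to_fract ` F \<subseteq> anderson_ring" using to_fract_in_anderson_ring by blast
  show "\<not> to_fract ` F \<subseteq> {0}" using F' by auto
  fix x assume x: "\<forall>f\<in>to_fract ` F. x * f \<in> anderson_ring"
  obtain s where s: "s \<in> anderson_set" "\<forall>y\<in>(\<lambda>f. x * to_fract f) ` F. to_fract s * y \<in> range to_fract"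
    using common_denominator[of UNIV "(\<lambda>f. x * to_fract f) ` F"] F' x
    by (auto simp: extend_poly_UNIV submodule_def)
  then have "\<forall>f\<in>to_fract ` F. (to_fract s * x) * f \<in> range to_fract" by (simp add: mult.assoc)
  then have "to_fract s * x \<in> range to_fract"
    using F unfolding gv_idom_def gv_set_def by blast
  then obtain f where "to_fract s * x = to_fract f" by blast
  then have "x = to_fract f / to_fract s" using anderson_nonzero[OF s(1)] by (simp add: field_simps)
  then show "x \<in> anderson_ring" using anderson_ring_fraction s(1) by blast
qed

text \<open>
  Contraction keeps \<open>w\<close>-ideals because GV sets of \<open>D[X]\<close> stay GV sets in the localization. A GV set
  of the localization, such as \<open>{1 + X}\<close>, need not be one of \<open>D[X]\<close>, so extension takes more work.
\<close>

lemma proper_w_ideal_contraction: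
  assumes m: "proper_w_ideal anderson_ring m"
  shows "proper_w_ideal (range to_fract) (to_fract ` {f. to_fract f \<in> m})"
proof -
  have sub: "submodule anderson_ring m" "m \<subseteq> anderson_ring" "m \<noteq> {0}" "1 \<notin> m"
    and closed: "\<And>x F. x \<in> anderson_ring \<Longrightarrow> gv_set anderson_ring F \<Longrightarrow> \<forall>f\<in>F. x * f \<in> m \<Longrightarrow> x \<in> m"
    using m unfolding proper_w_ideal_iff[OF anderson_ring_domain] by auto
  have "{f. to_fract f \<in> m} \<noteq> {0}"
  proof
    assume "{f. to_fract f \<in> m} = {0}"
    then have "extend_poly {0} = m" using extend_contraction[OF sub(1,2)] by simp
    moreover have "extend_poly {0} \<subseteq> {0 :: 'a poly fract}"
      unfolding extend_poly_def by (intro gen_least) (auto simp: submodule_def)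
    ultimately show False using sub(3) submodule_zero[OF sub(1)] by blast
  qed
  moreover have "to_fract f \<in> m" if "gv_idom F" "\<forall>h\<in>F. to_fract (f * h) \<in> m" for f F
    using that closed[OF to_fract_in_anderson_ring gv_idom_anderson] by auto
  ultimately show ?thesis
    unfolding proper_w_ideal_to_fract_iff using submodule_contraction[OF sub(1)] sub(4) by auto
qed

text \<open>
  This brings a GV set of the Anderson ring \<open>T\<close> that lies in \<open>PT\<close> back into \<open>P\<close>: \<open>F\<close> is a multiple of it
  by an element of \<open>A\<close>, and the last clause says that a fraction \<open>a / b\<close> that multiplies \<open>F\<close> into \<open>D[X]\<close>
  lies in \<open>T\<close>.
\<close>

lemma gv_set_clear_denominators:
  assumes G: "gv_set anderson_ring G" and P: "submodule UNIV P" "G \<subseteq> extend_poly P"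
  obtains F where "finite F" "F \<subseteq> P" "\<not> F \<subseteq> {0}"
    "\<And>a b. b \<noteq> 0 \<Longrightarrow> \<forall>f\<in>F. b dvd a * f \<Longrightarrow> \<exists>t\<in>anderson_set. b dvd a * t"
proof -
  have fin: "finite G" and nz: "\<not> G \<subseteq> {0}"
    and inv: "\<And>x. \<forall>g\<in>G. x * g \<in> anderson_ring \<Longrightarrow> x \<in> anderson_ring"
    using G unfolding gv_set_def by auto
  obtain s where s: "s \<in> anderson_set" "\<forall>x\<in>G. to_fract s * x \<in> to_fract ` P"
    using common_denominator[OF P(1) fin P(2)] by blast
  have s0: "to_fract s \<noteq> 0" by (rule anderson_nonzero[OF s(1)])
  have "(\<lambda>x. to_fract s * x) ` G \<subseteq> to_fract ` P" using s(2) by blast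
  then obtain F where F: "F \<subseteq> P" "finite F" "(\<lambda>x. to_fract s * x) ` G = to_fract ` F"
    using finite_subset_image[of "(\<lambda>x. to_fract s * x) ` G" to_fract P] fin by auto
  have clear: "\<exists>f\<in>F. to_fract s * x = to_fract f" if "x \<in> G" for x
    using that F(3) by (metis imageE imageI)
  show thesis
  proof (rule that[OF F(2,1)])
    show "\<not> F \<subseteq> {0}"
    proof
      assume F0: "F \<subseteq> {0}"
      have "x = 0" if x: "x \<in> G" for x
      proof -
        obtain f where "f \<in> F" "to_fract s * x = to_fract f" using clear[OF x] by blast
        moreover have "f = 0" using F0 \<open>f \<in> F\<close> by blast
        ultimately show ?thesis using s0 by simp
      qed
      then show False using nz by blast
    qed
    fix a b :: "'a poly" assume b: "b \<noteq> 0" and dvd: "\<forall>f\<in>F. b dvd a * f"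
    define z where "z = to_fract a / to_fract b * to_fract s"
    have "z * x \<in> anderson_ring" if x: "x \<in> G" for x
    proof -
      obtain f where f: "f \<in> F" "to_fract s * x = to_fract f" using clear[OF x] by blast
      obtain k where "a * f = b * k" using dvd f(1) by (meson dvdE)
      have "z * x = to_fract a / to_fract b * to_fract f" by (simp add: z_def mult.assoc f(2))
      also have "\<dots> = to_fract (a * f) / to_fract b" by simp
      also have "\<dots> = to_fract k" unfolding \<open>a * f = b * k\<close> using b by simp
      finally show ?thesis using to_fract_in_anderson_ring by metis
    qed
    then have "z \<in> anderson_ring" using inv by blast
    then obtain h t where ht: "z = to_fract h / to_fract t" "t \<in> anderson_set"
      unfolding anderson_ring_def by blast
    have "to_fract (a * (s * t)) = to_fract (b * h)"
      using ht(1) b anderson_nonzero[OF ht(2)] unfolding z_def by (simp add: field_simps)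
    then have "a * (s * t) = b * h" by (simp only: to_fract_eq_iff)
    then show "\<exists>t\<in>anderson_set. b dvd a * t"
      using anderson_mult[OF s(1) ht(2)] by (metis dvd_triv_left)
  qed
qed

section \<open>Extensions of maximal w-ideals of the base domain\<close>

lemma coeffs_in_disjoint_anderson:
  assumes "1 \<notin> M"
  shows "coeffs_in M \<inter> anderson_set = {}"
  using assms unfolding coeffs_in_def anderson_set_def poly_0_coeff_0
  by (auto dest: spec[of _ 0])

lemma maximal_w_ideal_idom_facts:
  assumes "maximal_w_ideal_idom M"
  shows "submodule UNIV M" "1 \<notin> M" "\<exists>b\<in>M. b \<noteq> 0" "\<And>F. gv_idom F \<Longrightarrow> \<not> F \<subseteq> M"
proof -
  note proper = maximal_w_ideal_idom_proper[OF assms]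
  show sub: "submodule UNIV M" and "1 \<notin> M"
    using proper unfolding proper_w_ideal_to_fract_iff by auto
  show "\<exists>b\<in>M. b \<noteq> 0"
    using proper submodule_zero[OF sub] unfolding proper_w_ideal_to_fract_iff by blast
  show "gv_idom F \<Longrightarrow> \<not> F \<subseteq> M" for F by (rule proper_w_ideal_no_gv_idom[OF proper])
qed

text \<open>
  The coefficients \<open>C\<close> of a finite \<open>F \<subseteq> M[X]\<close> are no GV set, since they lie in \<open>M\<close>. So some fraction
  \<open>x / y\<close> outside \<open>D\<close> multiplies \<open>F\<close> into \<open>D[X]\<close>. If \<open>F\<close> came from a GV set of the Anderson ring, \<open>x / y\<close>
  would lie in that ring, and comparing constant terms, which are \<open>1\<close> on \<open>A\<close>, would put it in \<open>D\<close>.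
\<close>

lemma proper_w_ideal_extend_coeffs_in:
  fixes M :: "'a::idom set"
  assumes M: "maximal_w_ideal_idom M"
  shows "proper_w_ideal anderson_ring (extend_poly (coeffs_in M))"
proof (rule prime_ideal_proper_w_ideal[OF anderson_ring_domain])
  note M' = maximal_w_ideal_idom_facts[OF M]
  note prime = prime_ideal_coeffs_in[OF maximal_w_ideal_idom_prime[OF M]]
    and disj = coeffs_in_disjoint_anderson[OF M'(2)]
  show "prime_ideal_of anderson_ring (extend_poly (coeffs_in M))"
    by (rule prime_ideal_extend_poly[OF prime disj])
  obtain b where b: "b \<in> M" "b \<noteq> 0" using M'(3) by blast
  have "to_fract (const_poly b) \<in> extend_poly (coeffs_in M)"
    unfolding to_fract_in_extend_poly_iff[OF prime disj]
    by (rule const_poly_in_coeffs_in[OF submodule_zero[OF M'(1)] b(1)])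
  moreover have "to_fract (const_poly b) \<noteq> 0" using b(2) by (simp add: const_poly_def)
  ultimately show "extend_poly (coeffs_in M) \<noteq> {0}" by blast
  show "\<not> G \<subseteq> extend_poly (coeffs_in M)" if G: "gv_set anderson_ring G" for G
  proof
    assume sub: "G \<subseteq> extend_poly (coeffs_in M)"
    have P: "submodule UNIV (coeffs_in M)" using prime unfolding prime_ideal_of_def ideal_of_def by blast
    obtain F where F: "finite F" "F \<subseteq> coeffs_in M" "\<not> F \<subseteq> {0}"
      and inv: "\<And>a b. b \<noteq> 0 \<Longrightarrow> \<forall>f\<in>F. b dvd a * f \<Longrightarrow> \<exists>t\<in>anderson_set. b dvd a * t"
      using gv_set_clear_denominators[OF G P sub] by blast
    define C where "C = (\<Union>f\<in>F. coeff f ` {..degree f})"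
    have "C \<subseteq> M" unfolding C_def using F(2) by (auto simp: coeffs_in_def)
    then have "\<not> gv_idom C" using M'(4) by blast
    moreover have "finite C" unfolding C_def using F(1) by simp
    moreover have "\<not> C \<subseteq> {0}"
    proof -
      obtain f where "f \<in> F" "f \<noteq> 0" using F(3) by blast
      then have "lead_coeff f \<in> C" "lead_coeff f \<noteq> 0" unfolding C_def by auto
      then show ?thesis by blast
    qed
    ultimately obtain x y where xy: "y \<noteq> 0" "\<forall>c\<in>C. y dvd x * c" "\<not> y dvd x"
      unfolding gv_idom_iff by blast
    have "[:y:] dvd [:x:] * f" if f: "f \<in> F" for f
      unfolding const_poly_dvd_iff
    proof
      fix n
      show "y dvd coeff ([:x:] * f) n"
      proof (cases "n \<le> degree f")
        case True
        then have "coeff f n \<in> C" unfolding C_def using f by blast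
        then show ?thesis using xy(2) by simp
      qed (simp add: coeff_eq_0)
    qed
    then obtain t where t: "t \<in> anderson_set" "[:y:] dvd [:x:] * t"
      using inv[of "[:y:]" "[:x:]"] xy(1) by auto
    then have "y dvd coeff ([:x:] * t) 0" unfolding const_poly_dvd_iff by blast
    then show False using t(1) xy(3) by (simp add: anderson_set_def poly_0_coeff_0)
  qed
qed

text \<open>
  A larger proper \<open>w\<close>-ideal contracts to an ideal \<open>q\<close> with some \<open>g \<in> q\<close> that has a coefficient \<open>a \<notin> M\<close>.
  By maximality of \<open>M\<close> there is a GV set in \<open>M + aD\<close>; the finitely many elements of \<open>M\<close> that occur in it,
  taken together with \<open>g\<close>, form a GV set of \<open>D[X]\<close> in \<open>q\<close>, which is impossible.
\<close>

lemma maximal_w_ideal_extend_base: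
  fixes M :: "'a::idom set"
  assumes M: "maximal_w_ideal_idom M"
  shows "maximal_w_ideal anderson_ring (extend_base M)"
proof -
  note M' = maximal_w_ideal_idom_facts[OF M]
  have "\<not> extend_poly (coeffs_in M) \<subset> I" if I: "proper_w_ideal anderson_ring I" for I
  proof
    assume less: "extend_poly (coeffs_in M) \<subset> I"
    have sub: "submodule anderson_ring I" "I \<subseteq> anderson_ring"
      using I unfolding proper_w_ideal_iff[OF anderson_ring_domain] by auto
    define q where "q = {f. to_fract f \<in> I}"
    have "to_fract ` coeffs_in M \<subseteq> extend_poly (coeffs_in M)"
      unfolding extend_poly_def by (rule gen_superset)
    then have Mq: "coeffs_in M \<subseteq> q" unfolding q_def using less by blast
    have "\<not> q \<subseteq> coeffs_in M"
      using extend_poly_mono[of q "coeffs_in M"] extend_contraction[OF sub] less unfolding q_def by blast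
    then obtain g n where g: "g \<in> q" "coeff g n \<notin> M" unfolding coeffs_in_def by blast
    obtain F where F: "gv_idom F" "\<forall>f\<in>F. \<exists>i\<in>M. \<exists>e. f = i + coeff g n * e"
      using gv_idom_adjoin[OF M g(2)] by blast
    then obtain i where i: "\<forall>f\<in>F. i f \<in> M \<and> (\<exists>e. f = i f + coeff g n * e)" by metis
    obtain b where b: "b \<in> M" "b \<noteq> 0" using M'(3) by blast
    \<comment> \<open>\<open>b\<close> is added because \<open>B\<close> needs a nonzero element\<close>
    define B where "B = insert b (i ` F)"
    have "gv_idom (insert g (const_poly ` B))"
    proof (rule gv_idom_const_polys_insert[where b = b])
      show "finite B" using F(1) by (simp add: B_def gv_idom_iff)
      fix x y assume y: "y \<noteq> 0" and B: "\<forall>a\<in>B. y dvd x * a" and coeffs: "\<forall>n. y dvd x * coeff g n"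
      have "y dvd x * f" if f: "f \<in> F" for f
      proof -
        obtain e where e: "f = i f + coeff g n * e" using i f by blast
        have "y dvd x * i f" using B f by (simp add: B_def)
        then have "y dvd x * i f + (x * coeff g n) * e"
          using coeffs by (intro dvd_add dvd_mult2[of y "x * coeff g n"]) auto
        also have "\<dots> = x * (i f + coeff g n * e)" by (simp add: algebra_simps)
        finally show ?thesis by (simp flip: e)
      qed
      then show "y dvd x" using F(1) y unfolding gv_idom_iff by blast
    qed (use b in \<open>auto simp: B_def\<close>)
    moreover have "B \<subseteq> M" using i b by (auto simp: B_def)
    then have "const_poly ` B \<subseteq> q"
      using const_poly_in_coeffs_in[OF submodule_zero[OF M'(1)]] Mq by blast
    ultimately show False
      using proper_w_ideal_no_gv_idom[OF proper_w_ideal_contraction[OF I]] g(1) unfolding q_def by blast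
  qed
  then show ?thesis
    unfolding extend_base_eq[OF M'(1)] maximal_w_ideal_def
    using proper_w_ideal_extend_coeffs_in[OF M] by blast
qed

section \<open>Uppers to zero\<close>

lemma ex_min_degree:
  assumes "submodule UNIV P" "P \<noteq> {0}"
  obtains f where "f \<in> P" "f \<noteq> 0" "\<And>g. g \<in> P \<Longrightarrow> g \<noteq> 0 \<Longrightarrow> degree f \<le> degree g"
proof -
  have "\<exists>f. f \<in> P \<and> f \<noteq> 0" using assms submodule_zero by blast
  then show thesis using that ex_has_least_nat[of "\<lambda>f. f \<in> P \<and> f \<noteq> 0" _ degree] by blast
qed

text \<open>
  The remainder of the pseudo-division of \<open>g\<close> by \<open>f\<close> lies in \<open>P\<close> and has smaller degree than \<open>f\<close>, so it
  vanishes. This stands for \<open>P\<close> generating a principal ideal over the quotient field.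
\<close>

lemma min_degree_dvd_multiple:
  fixes P :: "'a::idom poly set"
  assumes P: "submodule UNIV P" and f: "f \<in> P" "f \<noteq> 0"
    and min: "\<And>g. g \<in> P \<Longrightarrow> g \<noteq> 0 \<Longrightarrow> degree f \<le> degree g" and g: "g \<in> P"
  shows "\<exists>c. c \<noteq> 0 \<and> f dvd [:c:] * g"
proof -
  obtain q r where qr: "pseudo_divmod g f = (q, r)" by fastforce
  define c where "c = lead_coeff f ^ (Suc (degree g) - degree f)"
  have eq: "[:c:] * g = f * q + r" and r: "r = 0 \<or> degree r < degree f"
    using pseudo_divmod[OF f(2) qr] by (auto simp: c_def)
  have "r = [:c:] * g + (- q) * f" using eq by (simp add: algebra_simps)
  also have "\<dots> \<in> P" by (intro submodule_add[OF P] submodule_mult[OF P] f g UNIV_I)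
  finally have "r \<in> P" .
  then have "r = 0" using r min[of r] by fastforce
  moreover have "c \<noteq> 0" using f(2) by (simp add: c_def)
  ultimately show ?thesis using eq by (metis add.right_neutral dvd_triv_left)
qed

lemma upper_to_zero_facts:
  assumes "upper_to_zero P"
  shows "prime_ideal_of UNIV P" "submodule UNIV P" "P \<noteq> {0}" "c \<noteq> 0 \<Longrightarrow> [:c:] \<notin> P"
    "f * g \<in> P \<Longrightarrow> f \<in> P \<or> g \<in> P"
proof -
  show "prime_ideal_of UNIV P" "submodule UNIV P" "P \<noteq> {0}" "f * g \<in> P \<Longrightarrow> f \<in> P \<or> g \<in> P"
    using assms unfolding upper_to_zero_def prime_ideal_of_def ideal_of_def by auto
  show "[:c:] \<notin> P" if "c \<noteq> 0"
  proof
    assume "[:c:] \<in> P"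
    moreover have "[:c:] \<in> range const_poly" by (simp add: const_poly_def[abs_def])
    ultimately have "[:c:] = 0" using assms unfolding upper_to_zero_def by blast
    then show False using that by simp
  qed
qed

text \<open>
  Let \<open>h \<in> q\<close> and \<open>f \<in> p\<close> be nonzero of least degree. Then \<open>h \<notin> p\<close>, since otherwise every element of \<open>q\<close>
  would have a nonzero constant multiple in \<open>p\<close>, hence lie in \<open>p\<close>. As \<open>cf = hk\<close> for some nonzero \<open>c \<in> D\<close>,
  it follows that \<open>k \<in> p\<close>. So \<open>k\<close> has at least the degree of \<open>f\<close>, and \<open>h\<close> is constant.
\<close>

lemma ideal_above_upper_to_zero:
  fixes p :: "'a::idom poly set"
  assumes p: "upper_to_zero p" and q: "submodule UNIV q" "p \<subset> q"
  shows "\<exists>b. b \<noteq> 0 \<and> const_poly b \<in> q"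
proof -
  note p' = upper_to_zero_facts[OF p]
  have "q \<noteq> {0}" using submodule_zero[OF p'(2)] q(2) by blast
  then obtain h where h: "h \<in> q" "h \<noteq> 0" "\<And>g. g \<in> q \<Longrightarrow> g \<noteq> 0 \<Longrightarrow> degree h \<le> degree g"
    using ex_min_degree[OF q(1)] by blast
  have h_dvd: "\<exists>c. c \<noteq> 0 \<and> h dvd [:c:] * g" if "g \<in> q" for g
    using min_degree_dvd_multiple[OF q(1) h(1,2) _ that] h(3) by blast
  have "h \<notin> p"
  proof
    assume hp: "h \<in> p"
    obtain g where g: "g \<in> q" "g \<notin> p" using q(2) by blast
    obtain c k where "c \<noteq> 0" "[:c:] * g = h * k" using h_dvd[OF g(1)] by (meson dvdE)
    moreover have "k * h \<in> p" by (rule submodule_mult[OF p'(2) UNIV_I hp])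
    ultimately have "[:c:] * g \<in> p" "[:c:] \<notin> p" using p'(4) by (auto simp: mult.commute)
    then show False using p'(5) g(2) by blast
  qed
  obtain f where f: "f \<in> p" "f \<noteq> 0" "\<And>g. g \<in> p \<Longrightarrow> g \<noteq> 0 \<Longrightarrow> degree f \<le> degree g"
    using ex_min_degree[OF p'(2,3)] by blast
  obtain c k where c: "c \<noteq> 0" and k: "[:c:] * f = h * k"
    using h_dvd[of f] f(1) q(2) by (meson dvdE psubsetD)
  have "h * k \<in> p" unfolding k[symmetric] by (rule submodule_mult[OF p'(2) UNIV_I f(1)])
  then have "k \<in> p" using p'(5) \<open>h \<notin> p\<close> by blast
  moreover have "k \<noteq> 0" using k c f(2) by auto
  ultimately have "degree f \<le> degree k" by (rule f(3))
  moreover have "degree f = degree h + degree k"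
    using arg_cong[OF k, of degree] c h(2) \<open>k \<noteq> 0\<close> by (simp add: degree_mult_eq)
  ultimately have "degree h = 0" by simp
  then obtain b where "h = [:b:]" by (rule degree_eq_zeroE)
  then show ?thesis using h(1,2) by (auto simp: const_poly_def)
qed

text \<open>
  Let \<open>f \<in> p\<close> be nonzero of least degree. If a GV set lay in \<open>p\<close> up to denominators, some \<open>c / f\<close> with nonzero \<open>c \<in> D\<close>
  would multiply it into \<open>D[X]\<close> and hence lie in the Anderson ring. Then \<open>f\<close> would divide \<open>ct\<close> for some \<open>t \<in> A\<close>,
  so that \<open>ct \<in> p\<close>, although neither \<open>c\<close> nor \<open>t\<close> is in \<open>p\<close>.
\<close>

lemma proper_w_ideal_extend_upper_to_zero:
  fixes p :: "'a::idom poly set"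
  assumes p: "upper_to_zero p" and disj: "p \<inter> anderson_set = {}"
  shows "proper_w_ideal anderson_ring (extend_poly p)"
proof (rule prime_ideal_proper_w_ideal[OF anderson_ring_domain])
  note p' = upper_to_zero_facts[OF p]
  show "prime_ideal_of anderson_ring (extend_poly p)"
    by (rule prime_ideal_extend_poly[OF p'(1) disj])
  obtain f where f: "f \<in> p" "f \<noteq> 0" "\<And>g. g \<in> p \<Longrightarrow> g \<noteq> 0 \<Longrightarrow> degree f \<le> degree g"
    using ex_min_degree[OF p'(2,3)] by blast
  have "to_fract f \<in> extend_poly p" "to_fract f \<noteq> 0"
    using f(1,2) to_fract_in_extend_poly_iff[OF p'(1) disj] by auto
  then show "extend_poly p \<noteq> {0}" by blast
  show "\<not> G \<subseteq> extend_poly p" if G: "gv_set anderson_ring G" for G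
  proof
    assume sub: "G \<subseteq> extend_poly p"
    obtain F where F: "finite F" "F \<subseteq> p" and "\<not> F \<subseteq> {0}"
      and inv: "\<And>a b. b \<noteq> 0 \<Longrightarrow> \<forall>f\<in>F. b dvd a * f \<Longrightarrow> \<exists>t\<in>anderson_set. b dvd a * t"
      using gv_set_clear_denominators[OF G p'(2) sub] by blast
    have "\<exists>c. c \<noteq> 0 \<and> (\<forall>g\<in>F. f dvd [:c:] * g)"
      using F
    proof (induction F rule: finite_induct)
      case empty
      then show ?case by (intro exI[of _ 1]) simp
    next
      case (insert g F)
      then obtain c where c: "c \<noteq> 0" "\<forall>g\<in>F. f dvd [:c:] * g" by blast
      obtain d where d: "d \<noteq> 0" "f dvd [:d:] * g"
        using min_degree_dvd_multiple[OF p'(2) f(1,2), of g] f(3) insert.prems by blast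
      have "[:c * d:] * h = [:d:] * ([:c:] * h)" "[:c * d:] * h = [:c:] * ([:d:] * h)" for h
        by (simp_all add: mult.commute)
      then have "\<forall>h\<in>insert g F. f dvd [:c * d:] * h"
        using c(2) d(2) by (metis dvd_mult insert_iff)
      then show ?case using c(1) d(1) by (metis mult_eq_0_iff)
    qed
    then obtain c where c: "c \<noteq> 0" "\<forall>g\<in>F. f dvd [:c:] * g" by blast
    obtain t k where t: "t \<in> anderson_set" "[:c:] * t = f * k"
      using inv[OF f(2) c(2)] by (meson dvdE)
    have "k * f \<in> p" by (rule submodule_mult[OF p'(2) UNIV_I f(1)])
    then have "[:c:] * t \<in> p" unfolding t(2) by (simp add: mult.commute)
    then show False using p'(5) p'(4)[OF c(1)] t(1) disj by blast
  qed
qed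

lemma maximal_w_ideal_extend_upper_to_zero:
  fixes p :: "'a::idom poly set"
  assumes p: "maximal_w_ideal_idom p" "upper_to_zero p" and disj: "p \<inter> anderson_set = {}"
  shows "maximal_w_ideal anderson_ring (extend_poly p)"
proof -
  have "\<not> extend_poly p \<subset> I" if I: "proper_w_ideal anderson_ring I" for I
  proof
    assume less: "extend_poly p \<subset> I"
    have sub: "submodule anderson_ring I" "I \<subseteq> anderson_ring"
      using I unfolding proper_w_ideal_iff[OF anderson_ring_domain] by auto
    define q where "q = {f. to_fract f \<in> I}"
    have "to_fract ` p \<subseteq> extend_poly p" unfolding extend_poly_def by (rule gen_superset)
    then have "p \<subseteq> q" unfolding q_def using less by blast
    moreover have "p \<noteq> q"
      using extend_contraction[OF sub] less unfolding q_def by auto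
    ultimately have "to_fract ` p \<subset> to_fract ` q" by (metis image_mono inj_image_eq_iff injI psubsetI to_fract_eq_iff)
    then show False
      using p(1) proper_w_ideal_contraction[OF I]
      unfolding maximal_w_ideal_idom_def maximal_w_ideal_def q_def by blast
  qed
  then show ?thesis
    unfolding maximal_w_ideal_def using proper_w_ideal_extend_upper_to_zero[OF p(2) disj] by blast
qed

section \<open>Classification of the maximal w-ideals of the Anderson ring\<close>

text \<open>
  The ideal \<open>q\<close> is a parameter because two choices occur: the contraction of \<open>m\<close>, if it has a nonzero
  constant, and otherwise a proper \<open>w\<close>-ideal strictly above it.
\<close>

lemma maximal_w_ideal_anderson_eq_extend_base:
  fixes m :: "'a::idom poly fract set"
  assumes m: "maximal_w_ideal anderson_ring m" and q: "submodule UNIV q" "{f. to_fract f \<in> m} \<subseteq> q"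
    and b: "const_poly b \<in> q" "b \<noteq> 0" and no: "\<And>F. gv_idom F \<Longrightarrow> \<not> F \<subseteq> q"
  shows "\<exists>M. maximal_w_ideal_idom M \<and> m = extend_base M"
proof -
  obtain M where M: "maximal_w_ideal_idom M" "q \<subseteq> coeffs_in M"
    using ideal_subset_coeffs_in_maximal[OF q(1) b no] by blast
  have sub: "submodule anderson_ring m" "m \<subseteq> anderson_ring"
    using m unfolding maximal_w_ideal_def proper_w_ideal_iff[OF anderson_ring_domain] by auto
  have "m \<subseteq> extend_poly (coeffs_in M)"
    using extend_poly_mono[of "{f. to_fract f \<in> m}" "coeffs_in M"] q(2) M(2)
    unfolding extend_contraction[OF sub] by blast
  then have "m = extend_poly (coeffs_in M)"
    using m proper_w_ideal_extend_coeffs_in[OF M(1)] unfolding maximal_w_ideal_def by blast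
  then show ?thesis
    using M(1) extend_base_eq[OF maximal_w_ideal_idom_facts(1)[OF M(1)]] by metis
qed

lemma maximal_w_ideal_anderson_cases:
  fixes m :: "'a::idom poly fract set"
  assumes m: "maximal_w_ideal anderson_ring m"
  shows "(\<exists>M. maximal_w_ideal_idom M \<and> m = extend_base M) \<or>
    (\<exists>p. maximal_w_ideal_idom p \<and> upper_to_zero p \<and> p \<inter> anderson_set = {} \<and> m = extend_poly p)"
proof -
  have proper: "proper_w_ideal anderson_ring m" using m unfolding maximal_w_ideal_def by blast
  have sub: "submodule anderson_ring m" "m \<subseteq> anderson_ring" "1 \<notin> m"
    using proper unfolding proper_w_ideal_iff[OF anderson_ring_domain] by auto
  define p where "p = {f. to_fract f \<in> m}"
  have p_proper: "proper_w_ideal (range to_fract) (to_fract ` p)"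
    unfolding p_def by (rule proper_w_ideal_contraction[OF proper])
  then have p: "submodule UNIV p" "p \<noteq> {0}" unfolding proper_w_ideal_to_fract_iff by auto
  have m_eq: "m = extend_poly p" unfolding p_def by (rule extend_contraction[OF sub(1,2), symmetric])
  note extend = maximal_w_ideal_anderson_eq_extend_base[OF m, folded p_def]
  show ?thesis
  proof (cases "\<exists>b. b \<noteq> 0 \<and> const_poly b \<in> p")
    case True
    then show ?thesis using extend[of p] p(1) proper_w_ideal_no_gv_idom[OF p_proper] by blast
  next
    case False
    have const0: "const_poly 0 = (0 :: 'a poly)" by (simp add: const_poly_def)
    have "p \<inter> range const_poly = {0}"
    proof (intro equalityI subsetI)
      fix f assume "f \<in> p \<inter> range const_poly"
      then obtain b where "f = const_poly b" "const_poly b \<in> p" by blast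
      moreover from this have "b = 0" using False by blast
      ultimately show "f \<in> {0}" by (simp add: const0)
    next
      fix f :: "'a poly" assume "f \<in> {0}"
      then show "f \<in> p \<inter> range const_poly"
        using submodule_zero[OF p(1)] rangeI[of const_poly "0 :: 'a"] unfolding const0 by blast
    qed
    moreover have "prime_ideal_of UNIV p"
      unfolding p_def by (intro prime_ideal_contraction maximal_w_ideal_prime anderson_ring_domain m)
    ultimately have upper: "upper_to_zero p" using p(2) unfolding upper_to_zero_def by blast
    have disj: "p \<inter> anderson_set = {}"
    proof (rule ccontr)
      assume "p \<inter> anderson_set \<noteq> {}"
      then obtain f where f: "f \<in> p" "f \<in> anderson_set" by blast
      then have "to_fract f / to_fract f \<in> m" unfolding m_eq mem_extend_poly_iff[OF p(1)] by blast
      then show False using sub(3) anderson_nonzero[OF f(2)] by simp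
    qed
    show ?thesis
    proof (cases "maximal_w_ideal_idom p")
      case True
      then show ?thesis using upper disj m_eq by blast
    next
      case nonmax: False
      then obtain N where N: "proper_w_ideal (range to_fract) N" "to_fract ` p \<subset> N"
        using p_proper unfolding maximal_w_ideal_idom_def maximal_w_ideal_def by blast
      obtain q where q: "N = to_fract ` q"
        using N(1) unfolding proper_w_ideal_def by (meson psubset_imp_subset subset_imageE)
      have "p \<subset> q" using N(2) unfolding q by auto
      moreover have "submodule UNIV q" using N(1) unfolding q proper_w_ideal_to_fract_iff by blast
      ultimately obtain b where "b \<noteq> 0" "const_poly b \<in> q"
        using ideal_above_upper_to_zero[OF upper] by blast
      then show ?thesis
        using extend[of q] \<open>p \<subset> q\<close> \<open>submodule UNIV q\<close> proper_w_ideal_no_gv_idom[OF N(1)[unfolded q]]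
        by blast
    qed
  qed
qed

text \<open>
  Contracted to \<open>D\<close>, the first ideal contains the nonzero ideal \<open>M\<close>, whereas the second becomes zero.
\<close>

lemma extend_base_neq_extend_upper_to_zero:
  assumes M: "maximal_w_ideal_idom M" and p: "upper_to_zero p" "p \<inter> anderson_set = {}"
  shows "extend_base M \<noteq> extend_poly p"
proof
  assume eq: "extend_base M = extend_poly p"
  note M' = maximal_w_ideal_idom_facts[OF M] and p' = upper_to_zero_facts[OF p(1)]
  obtain b where b: "b \<in> M" "b \<noteq> 0" using M'(3) by blast
  have "to_fract (const_poly b) \<in> extend_base M"
    unfolding extend_base_def by (intro subsetD[OF gen_superset] imageI b(1))
  then have "const_poly b \<in> p"
    unfolding eq to_fract_in_extend_poly_iff[OF p'(1) p(2)] .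
  then show False using p'(4)[OF b(2)] by (simp add: const_poly_def)
qed

theorem theorem4p5:
  fixes m :: "'a::idom poly fract set"
  shows "maximal_w_ideal anderson_ring m \<longleftrightarrow>
    ((\<exists>M :: 'a set. maximal_w_ideal_idom M \<and> m = extend_base M) \<noteq>
     (\<exists>p :: 'a poly set. maximal_w_ideal_idom p \<and> upper_to_zero p \<and>
        p \<inter> anderson_set = {} \<and> m = extend_poly p))"
  (is "_ \<longleftrightarrow> (?base \<noteq> ?upper)")
proof -
  have "?base \<Longrightarrow> maximal_w_ideal anderson_ring m" using maximal_w_ideal_extend_base by blast
  moreover have "?upper \<Longrightarrow> maximal_w_ideal anderson_ring m"
    using maximal_w_ideal_extend_upper_to_zero by blast
  moreover have "maximal_w_ideal anderson_ring m \<Longrightarrow> ?base \<or> ?upper"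
    by (rule maximal_w_ideal_anderson_cases)
  moreover have "\<not> (?base \<and> ?upper)" using extend_base_neq_extend_upper_to_zero by blast
  ultimately show ?thesis by argo
qed

end
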